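(* Let $r\geq 5$ be an integer and let $0<\gamma<\frac14$ be a constant. Then there is a real constant $c>0$ and, for each $n$, an $n$-vertex graph $G_n$ with $|E(G_n)|\geq\gamma n^2$ such that for $p=p(n)\leq c\,n^{-1/m_2(K_{\lceil r/2\rceil},K_r)}$, asymptotically almost surely $G_n\cup G(n,p)\not\rightarrow (K_r)$.
   Context: $G(n,p)$ is the binomial random graph on the vertex set of $G_n$, each edge present independently with probability $p$; $G_n\cup G(n,p)$ is the union of edge sets. "Asymptotically almost surely" means with probability tending to $1$ as $n\to\infty$. $G\not\rightarrow(K_r)$ means there is a 2-colouring of $E(G)$ with no monochromatic copy of $K_r$. For a graph $H=(V,E)$, $d_2(H)=\frac{|E|-1}{|V|-2}$ if $|V|\ge 3$ and $|E|>0$, $d_2(K_2)=1/2$, and $d_2(H)=0$ if $|E|=0$; $m_2(H)=\max_{J\subseteq H}d_2(J)$. For graphs $G,H$ with at least one edge, $d_2(G,H)=\frac{|E(H)|}{|V(H)|-2+1/m_2(G)}$ and $m_2(G,H)=\max_{J\subseteq H}d_2(G,J)$ (maximum over subgraphs $J$ of $H$ with at least one edge).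
   Formalization: "For each n" is read as "for each n ≥ 2", because for n = 1 a one-vertex graph has no edges and cannot satisfy |E(G_n)| ≥ γn² > 0; the asymptotic claim is unaffected. *)

theory Defs
  imports "HOL-Probability.Probability" "HOL-Library.Ramsey"
begin

record 'a graph =
  verts :: "'a set"
  edges :: "'a set set"

definition fin_graph :: "'a graph \<Rightarrow> bool" where
  "fin_graph G \<longleftrightarrow> finite (verts G) \<and> edges G \<subseteq> [verts G]\<^bsup>2\<^esup>"

definition subgraph :: "'a graph \<Rightarrow> 'a graph \<Rightarrow> bool" where
  "subgraph J H \<longleftrightarrow> fin_graph J \<and> verts J \<subseteq> verts H \<and> edges J \<subseteq> edges H"

definition graph_union :: "'a graph \<Rightarrow> 'a graph \<Rightarrow> 'a graph" where
  "graph_union G H = \<lparr>verts = verts G \<union> verts H, edges = edges G \<union> edges H\<rparr>"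

definition clique_graph :: "nat \<Rightarrow> nat graph" where
  "clique_graph r = \<lparr>verts = {..<r}, edges = [{..<r}]\<^bsup>2\<^esup>\<rparr>"

text \<open>A two-vertex graph with an edge is \<open>K\<^sub>2\<close>, which has value \<open>1/2\<close> by convention.\<close>

definition d2 :: "'a graph \<Rightarrow> real" where
  "d2 H = (if edges H = {} then 0
           else if card (verts H) = 2 then 1 / 2
           else (real (card (edges H)) - 1) / (real (card (verts H)) - 2))"

definition m2 :: "'a graph \<Rightarrow> real" where
  "m2 H = Max {d2 J |J. subgraph J H}"

definition d2_pair :: "'a graph \<Rightarrow> 'b graph \<Rightarrow> real" where
  "d2_pair G H = real (card (edges H)) / (real (card (verts H)) - 2 + 1 / m2 G)"

definition m2_pair :: "'a graph \<Rightarrow> 'b graph \<Rightarrow> real" where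
  "m2_pair G H = Max {d2_pair G J |J. subgraph J H \<and> edges J \<noteq> {}}"

text \<open>A 2-colouring of the edges of \<open>G\<close> is given as a function on all sets of vertices; its
  values outside \<open>edges G\<close> are irrelevant. A copy of \<open>H\<close> is a not necessarily induced one.\<close>

definition mono_copy :: "('a set \<Rightarrow> bool) \<Rightarrow> 'a graph \<Rightarrow> 'b graph \<Rightarrow> bool" where
  "mono_copy col G H \<longleftrightarrow>
     (\<exists>f b. inj_on f (verts H) \<and> f ` verts H \<subseteq> verts G \<and>
            (\<forall>e\<in>edges H. f ` e \<in> edges G \<and> col (f ` e) = b))"

definition arrows :: "'a graph \<Rightarrow> 'b graph \<Rightarrow> bool" where
  "arrows G H \<longleftrightarrow> (\<forall>col. mono_copy col G H)"

definition binomial_random_graph :: "'a set \<Rightarrow> real \<Rightarrow> 'a graph pmf" where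
  "binomial_random_graph V p =
     map_pmf (\<lambda>X. \<lparr>verts = V, edges = {e \<in> [V]\<^bsup>2\<^esup>. X e}\<rparr>)
       (Pi_pmf ([V]\<^bsup>2\<^esup>) False (\<lambda>_. bernoulli_pmf p))"

end

theory Submission
  imports Defs
begin

text \<open>
  Put \<open>s = \<lceil>r/2\<rceil>\<close>, take \<open>G\<^sub>n\<close> complete bipartite and colour all cross edges red. A red
  \<open>K\<^sub>r\<close> has a red \<open>K\<^sub>s\<close> inside one of the two parts and a blue one has no cross edge, so it
  suffices to find in \<open>G(n,p)\<close> a \<open>K\<^sub>s\<close>-free set \<open>R\<close> of edges that hits every \<open>K\<^sub>r\<close>.

  If there is no such \<open>R\<close>, consider a minimal family of \<open>r\<close>-cliques that cannot be hit. By
  minimality its union has minimum degree at least \<open>r + 1\<close>, and each edge of a clique \<open>Q\<close> of the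
  family lies in a \<open>K\<^sub>s\<close> that meets \<open>Q\<close> in this edge only, and every edge of which is cut out
  by a clique of the family in the same way. Explore the family from one clique, adding at each step
  either a clique sharing an edge with the current graph, or such a \<open>K\<^sub>s\<close> with the cliques on
  its new edges. With \<open>m = m\<^sub>2(K\<^sub>s, K\<^sub>r)\<close> a step adding \<open>v\<close> vertices and \<open>e\<close>
  edges multiplies the expected count by about \<open>n\<^sup>v p\<^sup>e\<close>, and \<open>v - e/m \<le> 0\<close>. In the case of
  equality the step is attached to a single edge and creates vertices of degree \<open>r - 1\<close>, so the
  next step may be taken at an edge prescribed by the current graph, which makes the number of
  choices constant; all other steps are paid for by a power of \<open>n\<close>. For small \<open>c\<close> the expected number of
  explorations with \<open>log n\<close> steps therefore tends to 0. An exploration that stops earlier has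
  found a graph with \<open>O(log n)\<close> vertices and minimum degree at least \<open>r + 1 > 2m\<close>, and the
  expected number of these also tends to 0.
\<close>

section \<open>Pairs of vertices as edges\<close>

lemma nsets2_iff: "e \<in> [A]\<^bsup>2\<^esup> \<longleftrightarrow> e \<subseteq> A \<and> card e = 2"
  by (auto simp: nsets_def card_eq_0_iff intro: card_ge_0_finite)

lemma Union_nsets2:
  assumes "finite A" "2 \<le> card A"
  shows "\<Union>([A]\<^bsup>2\<^esup>) = A"
proof
  show "A \<subseteq> \<Union>([A]\<^bsup>2\<^esup>)"
  proof
    fix x assume x: "x \<in> A"
    have "A \<noteq> {x}" using assms by auto
    then obtain y where "y \<in> A" "y \<noteq> x" using x by auto
    then have "{x, y} \<in> [A]\<^bsup>2\<^esup>" using x by (auto simp: nsets2_iff)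
    then show "x \<in> \<Union>([A]\<^bsup>2\<^esup>)" by blast
  qed
qed (auto simp: nsets2_iff)

lemma finite_Union_edges:
  "finite S \<Longrightarrow> \<forall>e\<in>S. card e = 2 \<Longrightarrow> finite (\<Union>S)"
  by (metis card.infinite finite_Union zero_neq_numeral)

lemma two_choose: "2 * int (n choose 2) = int n * (int n - 1)"
proof -
  have "2 * (n choose 2) = n * (n - 1)"
    unfolding choose_two by (rule dvd_mult_div_cancel) auto
  then have "2 * int (n choose 2) = int (n * (n - 1))"
    by (metis of_nat_mult of_nat_numeral)
  then show ?thesis by (cases n) (auto simp: algebra_simps)
qed

lemma three_le_card:
  assumes "finite A" "e \<subseteq> A" "f \<subseteq> A" "card e = 2" "card f = 2" "e \<noteq> f"
  shows "3 \<le> card A"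
proof -
  have "finite e" "finite f" using assms finite_subset by auto
  have "\<not> f \<subseteq> e" using card_subset_eq[OF \<open>finite e\<close>, of f] assms by auto
  then have "e \<subset> e \<union> f" by blast
  then have "card e < card (e \<union> f)" using \<open>finite e\<close> \<open>finite f\<close> by (intro psubset_card_mono) auto
  moreover have "card (e \<union> f) \<le> card A" using assms by (intro card_mono) auto
  ultimately show ?thesis using assms by linarith
qed

text \<open>A further common vertex would form a second common pair together with an end of
  \<open>e\<close>.\<close>

lemma inter_of_single_common_edge:
  assumes "[A]\<^bsup>2\<^esup> \<inter> [Q]\<^bsup>2\<^esup> = {e}"
  shows "A \<inter> Q = e"
proof -
  have "e \<in> [A]\<^bsup>2\<^esup>" "e \<in> [Q]\<^bsup>2\<^esup>" using assms by blast+
  then have e: "e \<subseteq> A \<inter> Q" "card e = 2" by (simp_all add: nsets2_iff)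
  have "A \<inter> Q \<subseteq> e"
  proof
    fix x assume x: "x \<in> A \<inter> Q"
    obtain u v where "e = {u, v}" "u \<noteq> v" using e(2) unfolding card_2_iff by blast
    then obtain y where y: "y \<in> e" "y \<noteq> x" by blast
    then have "y \<in> A" "y \<in> Q" "card {x, y} = 2" using e(1) by auto
    then have "{x, y} \<in> [A]\<^bsup>2\<^esup> \<inter> [Q]\<^bsup>2\<^esup>" using x by (simp add: nsets2_iff)
    then have "{x, y} = e" unfolding assms by (rule singletonD)
    then show "x \<in> e" by (rule subst) simp
  qed
  then show ?thesis using e by auto
qed

subsection \<open>The potential\<close>

locale clique_pair =
  fixes r s :: nat
  assumes s3: "3 \<le> s" and sr: "s < r"
begin

text \<open>
  \<open>m\<^sub>2(K\<^sub>s, K\<^sub>r) = vweight / eweight\<close>, so at \<open>p = n powr (- 1 / m\<^sub>2)\<close> one has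
  \<open>n ^ v * p ^ e = n powr (potential / vweight)\<close>.
\<close>

definition vweight :: int where "vweight = int ((s + 1) * (r choose 2))"
definition eweight :: int where "eweight = int ((r - 2) * (s + 1) + 2)"

definition potential :: "'a set set \<Rightarrow> int" where
  "potential S = vweight * int (card (\<Union>S)) - eweight * int (card S)"

lemma two_choose_r: "2 * int (r choose 2) = int r * (int r - 1)" by (rule two_choose)

lemma choose_r_pos: "int (r choose 2) > 0" using s3 sr by simp

lemma eweight_eq: "eweight = (int r - 2) * (int s + 1) + 2"
  using s3 sr by (simp add: eweight_def of_nat_diff) (simp add: algebra_simps)

lemma vweight_eq: "vweight = (int s + 1) * int (r choose 2)"
  by (simp add: vweight_def algebra_simps)

lemma vweight_pos: "vweight > 0" using choose_r_pos by (simp add: vweight_eq)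
lemma eweight_pos: "eweight > 0" unfolding eweight_def by linarith

text \<open>Since \<open>s < r\<close>, the density \<open>vweight / eweight\<close> lies strictly
  below \<open>(r + 1) / 2\<close>. This is used for a clique glued on along an edge and for graphs
  of average degree at least \<open>r + 1\<close>.\<close>

lemma eweight_vweight: "eweight * (int r + 1) = 2 * vweight + 2 * (int r - int s)"
proof -
  have "2 * vweight = (int s + 1) * (int r * (int r - 1))"
    using two_choose_r by (metis mult.left_commute vweight_eq)
  then show ?thesis by (simp add: eweight_eq algebra_simps)
qed

lemma r_set:
  assumes "card Q = r"
  shows "finite Q" "\<Union>([Q]\<^bsup>2\<^esup>) = Q" "finite ([Q]\<^bsup>2\<^esup>)"
proof -
  show "finite Q" using assms s3 sr by (auto intro: card_ge_0_finite)
  then show "\<Union>([Q]\<^bsup>2\<^esup>) = Q" "finite ([Q]\<^bsup>2\<^esup>)"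
    using assms s3 sr by (simp_all add: Union_nsets2 finite_imp_finite_nsets)
qed

lemma potential_clique:
  assumes "card Q = r"
  shows "potential ([Q]\<^bsup>2\<^esup>) = 2 * int s * int (r choose 2)"
  using assms r_set(2)[OF assms] by (simp add: potential_def card_nsets vweight_eq eweight_eq algebra_simps)

text \<open>If \<open>Q\<close> has exactly \<open>j \<ge> 2\<close> vertices in common with
  \<open>S\<close>, it brings \<open>r - j\<close> new vertices and at least
  \<open>(r - j) * (r + j - 1) / 2\<close> new edges. That is at least \<open>(r + 1) / 2\<close>
  edges per new vertex, more than \<open>vweight / eweight\<close>. For \<open>j = r\<close> there
  is no new vertex but some new edge.\<close>

lemma potential_add_clique:
  assumes S: "finite S" "\<forall>e\<in>S. card e = 2" and Q: "card Q = r"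
    and meet: "[Q]\<^bsup>2\<^esup> \<inter> S \<noteq> {}" and new: "\<not> [Q]\<^bsup>2\<^esup> \<subseteq> S"
  shows "potential (S \<union> [Q]\<^bsup>2\<^esup>) < potential S"
proof -
  note fQ = r_set(1)[OF Q] and UQ = r_set(2)[OF Q] and fQ2 = r_set(3)[OF Q]
  have fV: "finite (\<Union>S)" using S by (rule finite_Union_edges)
  define j where "j = card (Q \<inter> \<Union>S)"
  obtain e where e: "e \<in> [Q]\<^bsup>2\<^esup>" "e \<in> S" using meet by auto
  then have "e \<subseteq> Q \<inter> \<Union>S" "card e = 2" by (auto simp: nsets2_iff)
  then have j2: "2 \<le> j" unfolding j_def using fQ by (metis card_mono finite_Int)
  have jr: "j \<le> r" unfolding j_def using fQ Q by (metis Int_lower1 card_mono)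
  have V: "card (\<Union>(S \<union> [Q]\<^bsup>2\<^esup>)) + j = card (\<Union>S) + r"
    using card_Un_Int[OF fV fQ] Q UQ by (simp add: j_def Int_commute)
  have E: "card (S \<union> [Q]\<^bsup>2\<^esup>) = card S + card ([Q]\<^bsup>2\<^esup> - S)"
    using S fQ2 by (metis Un_Diff_cancel card_Un_disjoint Diff_disjoint finite_Diff)
  have E1: "card ([Q]\<^bsup>2\<^esup> - S) \<ge> 1" using new fQ2
    by (metis Diff_eq_empty_iff One_nat_def Suc_leI card_gt_0_iff finite_Diff)
  have sub: "[Q]\<^bsup>2\<^esup> \<inter> S \<subseteq> [Q \<inter> \<Union>S]\<^bsup>2\<^esup>" by (auto simp: nsets2_iff)
  have "card ([Q]\<^bsup>2\<^esup> \<inter> S) \<le> j choose 2"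
    using card_mono[OF finite_imp_finite_nsets[of "Q \<inter> \<Union>S"] sub] fQ by (simp add: card_nsets j_def)
  moreover have "card ([Q]\<^bsup>2\<^esup> - S) + card ([Q]\<^bsup>2\<^esup> \<inter> S) = r choose 2"
    using fQ2 Q by (metis card_Diff_subset_Int card_Int_Diff card_nsets add.commute)
  ultimately have E2: "int (r choose 2) - int (j choose 2) \<le> int (card ([Q]\<^bsup>2\<^esup> - S))"
    by linarith
  have d: "potential (S \<union> [Q]\<^bsup>2\<^esup>) - potential S = vweight * (int r - int j) - eweight * int (card ([Q]\<^bsup>2\<^esup> - S))"
  proof -
    have "int (card (\<Union>(S \<union> [Q]\<^bsup>2\<^esup>))) = int (card (\<Union>S)) + int r - int j" using V by linarith
    then show ?thesis unfolding potential_def E by (simp only: of_nat_add) (simp only: algebra_simps)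
  qed
  have "vweight * (int r - int j) < eweight * int (card ([Q]\<^bsup>2\<^esup> - S))"
  proof (cases "j = r")
    case True
    then show ?thesis using E1 eweight_pos by simp
  next
    case False
    then have jr': "int r - int j > 0" using jr by simp
    have "2 * vweight < eweight * (int r + 1)" using eweight_vweight sr by simp
    also have "\<dots> \<le> eweight * (int r + int j - 1)" using j2 eweight_pos by simp
    finally have "2 * vweight * (int r - int j) < eweight * (int r + int j - 1) * (int r - int j)"
      using jr' by simp
    also have "\<dots> = eweight * (2 * (int (r choose 2) - int (j choose 2)))"
      unfolding right_diff_distrib two_choose_r two_choose[of j] by (simp add: algebra_simps)
    also have "\<dots> \<le> eweight * (2 * int (card ([Q]\<^bsup>2\<^esup> - S)))"
      using E2 eweight_pos by (intro mult_left_mono) auto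
    finally show ?thesis by simp
  qed
  then show ?thesis using d by linarith
qed

text \<open>The cliques are indexed because in an extension step each is tied to the edge of the K_s
  that it is put on; \<open>edge_union\<close> below is the case of the identity.\<close>

definition clique_edges :: "('b \<Rightarrow> 'a set) \<Rightarrow> 'b set \<Rightarrow> 'a set set" where
  "clique_edges Q N = (\<Union>f\<in>N. [Q f]\<^bsup>2\<^esup>)"

lemma clique_edges_props:
  assumes "finite N" "\<forall>f\<in>N. card (Q f) = r"
  shows "finite (clique_edges Q N)" "\<forall>e\<in>clique_edges Q N. card e = 2" "\<Union>(clique_edges Q N) = (\<Union>f\<in>N. Q f)"
    "finite (\<Union>(clique_edges Q N))"
proof -
  have f: "finite (Q f)" "\<Union>([Q f]\<^bsup>2\<^esup>) = Q f" if "f \<in> N" for f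
    using r_set[of "Q f"] that assms by auto
  show 1: "finite (clique_edges Q N)" using assms f unfolding clique_edges_def by (auto intro: finite_imp_finite_nsets)
  show 2: "\<forall>e\<in>clique_edges Q N. card e = 2" by (auto simp: clique_edges_def nsets2_iff)
  show "\<Union>(clique_edges Q N) = (\<Union>f\<in>N. Q f)" using f(2) unfolding clique_edges_def by (simp add: UN_UN_flatten[where A=N and B="\<lambda>f. [Q f]\<^bsup>2\<^esup>" and C="\<lambda>x. x", simplified])
  show "finite (\<Union>(clique_edges Q N))" using 1 2 by (rule finite_Union_edges)
qed

lemma clique_edges_insert: "clique_edges Q (insert g N) = clique_edges Q N \<union> [Q g]\<^bsup>2\<^esup>"
  by (auto simp: clique_edges_def)

text \<open>\<open>K\<close> is a largest subfamily that contains \<open>f0\<close> and obeys the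
  potential bounds, whose reference value is the potential of a single clique. A clique outside
  \<open>K\<close> sharing an edge with it could be added without violating them, by
  \<open>potential_add_clique\<close>, so there is none.\<close>

lemma edge_connected_class:
  assumes N: "finite N" "f0 \<in> N" and Q: "\<forall>f\<in>N. card (Q f) = r" and inj: "inj_on Q N"
  obtains K where "K \<subseteq> N" "f0 \<in> K" "clique_edges Q K \<inter> clique_edges Q (N - K) = {}"
    "potential (clique_edges Q K) \<le> 2 * int s * int (r choose 2)"
    "card K \<ge> 2 \<Longrightarrow> potential (clique_edges Q K) < 2 * int s * int (r choose 2)"
proof -
  define P where "P K \<longleftrightarrow> K \<subseteq> N \<and> f0 \<in> K \<and> potential (clique_edges Q K) \<le> 2 * int s * int (r choose 2) \<and>
    (card K \<ge> 2 \<longrightarrow> potential (clique_edges Q K) < 2 * int s * int (r choose 2))" for K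
  have "P {f0}" using N Q by (auto simp: P_def clique_edges_def potential_clique)
  moreover have "\<forall>K. P K \<longrightarrow> card K \<le> card N" using N by (auto simp: P_def intro: card_mono)
  ultimately obtain K where K: "P K" and mx: "\<And>K'. P K' \<Longrightarrow> card K' \<le> card K"
    using ex_has_greatest_nat[of P "{f0}" card "Suc (card N)"] by (metis le_imp_less_Suc)
  have KN: "K \<subseteq> N" "finite K" "f0 \<in> K" using K N finite_subset by (auto simp: P_def)
  have QK: "\<forall>f\<in>K. card (Q f) = r" using Q KN(1) by blast
  note fin = clique_edges_props(1,2)[OF KN(2) QK]
  have "clique_edges Q K \<inter> [Q g]\<^bsup>2\<^esup> = {}" if g: "g \<in> N - K" for g
  proof (rule ccontr)
    assume meet: "clique_edges Q K \<inter> [Q g]\<^bsup>2\<^esup> \<noteq> {}"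
    have "potential (clique_edges Q (insert g K)) < 2 * int s * int (r choose 2)"
    proof (cases "[Q g]\<^bsup>2\<^esup> \<subseteq> clique_edges Q K")
      case True
      \<comment> \<open>Here the potential stays the same, so strictness must already hold for
        \<open>K\<close>. A single clique cannot cover another one, as both have \<open>r\<close>
        vertices and \<open>Q\<close> is injective.\<close>
      have "card K \<ge> 2"
      proof (rule ccontr)
        assume "\<not> card K \<ge> 2"
        moreover have "card K \<noteq> 0" using KN by auto
        ultimately have "card K = 1" by linarith
        then have K1: "K = {f0}" using KN(3) by (metis card_1_singletonE singletonD)
        have fg: "f0 \<in> N" "g \<in> N" "f0 \<noteq> g" using KN g by auto
        have "[Q g]\<^bsup>2\<^esup> \<subseteq> [Q f0]\<^bsup>2\<^esup>" using True K1 by (simp add: clique_edges_def)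
        then have "\<Union>([Q g]\<^bsup>2\<^esup>) \<subseteq> \<Union>([Q f0]\<^bsup>2\<^esup>)" by (rule Union_mono)
        then have "Q g \<subseteq> Q f0" using r_set(2)[of "Q g"] r_set(2)[of "Q f0"] Q fg by simp
        then have "Q g = Q f0" using fg Q r_set(1)[of "Q f0"] by (intro card_subset_eq) auto
        then show False using inj fg by (auto dest: inj_onD)
      qed
      then have "potential (clique_edges Q K) < 2 * int s * int (r choose 2)" using K by (simp add: P_def)
      then show ?thesis using True by (simp add: clique_edges_insert Un_absorb2)
    next
      case False
      have "potential (clique_edges Q (insert g K)) < potential (clique_edges Q K)"
        unfolding clique_edges_insert using fin g Q meet False by (intro potential_add_clique) auto
      then show ?thesis using K by (simp add: P_def)
    qed
    then have "P (insert g K)" using g KN by (auto simp: P_def)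
    then have "card (insert g K) \<le> card K" by (rule mx)
    then show False using g KN by simp
  qed
  then have "clique_edges Q K \<inter> clique_edges Q (N - K) = {}" by (auto simp: clique_edges_def)
  with that K show ?thesis by (auto simp: P_def)
qed

text \<open>
  Here \<open>W\<close> spans the new \<open>K\<^sub>s\<close>, \<open>N\<close> consists of its new edges, and \<open>Q f\<close> is the clique
  put on \<open>f\<close>. A class of cliques connected through shared edges that meets \<open>W\<close> in \<open>w\<close>
  vertices contains at most \<open>w choose 2\<close> elements of \<open>N\<close>, and the claim for the class reduces to
  \<open>(w - 2) * (s - w) \<ge> 0\<close>; distinct classes are edge-disjoint.
\<close>

lemma potential_outside:
  assumes W: "card W = s"
    and N: "finite N" "N \<subseteq> [W]\<^bsup>2\<^esup>" "\<forall>f\<in>N. card (Q f) = r" "\<forall>f\<in>N. Q f \<inter> W = f"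
  shows "vweight * int (card (\<Union>(clique_edges Q N) - W)) - eweight * int (card (clique_edges Q N)) \<le> - 2 * int (r choose 2) * int (card N)"
    and "vweight * int (card (\<Union>(clique_edges Q N) - W)) - eweight * int (card (clique_edges Q N)) = - 2 * int (r choose 2) * int (card N)
      \<Longrightarrow> \<forall>f\<in>N. \<forall>g\<in>N. f \<noteq> g \<longrightarrow> Q f \<inter> Q g \<subseteq> W"
proof -
  have fW: "finite W" using W s3 by (auto intro: card_ge_0_finite)
  \<comment> \<open>Vertices of \<open>W\<close> are left out because
    \<open>potential_extend\<close> accounts for them separately. The edges are all counted,
    including the elements of \<open>M\<close>, which lie inside \<open>W\<close>.\<close>
  define D where "D M = vweight * int (card (\<Union>(clique_edges Q M) - W)) - eweight * int (card (clique_edges Q M))" for M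
  have "D N \<le> - 2 * int (r choose 2) * int (card N) \<and>
    (D N = - 2 * int (r choose 2) * int (card N) \<longrightarrow> (\<forall>f\<in>N. \<forall>g\<in>N. f \<noteq> g \<longrightarrow> Q f \<inter> Q g \<subseteq> W))"
    using N
  \<comment> \<open>A whole class \<open>K\<close> is split off at a time, so the induction
    hypothesis is applied to \<open>N - K\<close>.\<close>
  proof (induction rule: finite_psubset_induct)
    case (psubset N)
    show ?case
    proof (cases "N = {}")
      case True
      then show ?thesis by (simp add: D_def clique_edges_def)
    next
      case False
      then obtain f0 where f0: "f0 \<in> N" by auto
      have "inj_on Q N" using psubset.prems(3) by (metis inj_onI)
      then obtain K where K: "K \<subseteq> N" "f0 \<in> K" "clique_edges Q K \<inter> clique_edges Q (N - K) = {}"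
        "potential (clique_edges Q K) \<le> 2 * int s * int (r choose 2)"
        "card K \<ge> 2 \<Longrightarrow> potential (clique_edges Q K) < 2 * int s * int (r choose 2)"
        using edge_connected_class[OF psubset.hyps f0 psubset.prems(2)] by blast
      let ?M = "N - K"
      have fK: "finite K" "finite ?M" using K psubset.hyps finite_subset by auto
      have QK: "\<forall>f\<in>K. card (Q f) = r" "\<forall>f\<in>?M. card (Q f) = r" using psubset.prems K by auto
      note cK = clique_edges_props[OF fK(1) QK(1)] and cM = clique_edges_props[OF fK(2) QK(2)]
      have NK: "N = K \<union> ?M" using K by auto
      have clN: "clique_edges Q N = clique_edges Q K \<union> clique_edges Q ?M" by (subst NK) (auto simp: clique_edges_def)
      have IH: "D ?M \<le> - 2 * int (r choose 2) * int (card ?M)"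
        "D ?M = - 2 * int (r choose 2) * int (card ?M) \<longrightarrow> (\<forall>f\<in>?M. \<forall>g\<in>?M. f \<noteq> g \<longrightarrow> Q f \<inter> Q g \<subseteq> W)"
      proof -
        have "?M \<subset> N" "?M \<subseteq> [W]\<^bsup>2\<^esup>" "\<forall>f\<in>?M. Q f \<inter> W = f" using K f0 psubset.prems by auto
        from psubset.IH[OF this(1) this(2) QK(2) this(3)]
        show "D ?M \<le> - 2 * int (r choose 2) * int (card ?M)"
          "D ?M = - 2 * int (r choose 2) * int (card ?M) \<longrightarrow> (\<forall>f\<in>?M. \<forall>g\<in>?M. f \<noteq> g \<longrightarrow> Q f \<inter> Q g \<subseteq> W)"
          by auto
      qed
      define w where "w = card (\<Union>(clique_edges Q K) \<inter> W)"
      have sub: "f \<subseteq> \<Union>(clique_edges Q K) \<inter> W" if "f \<in> K" for f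
      proof -
        have "Q f \<inter> W = f" using that psubset.prems(3) K(1) by auto
        then show ?thesis unfolding cK(3) using that by auto
      qed
      have fin: "finite (\<Union>(clique_edges Q K) \<inter> W)" using fW by auto
      have c2: "card f = 2" if "f \<in> K" for f using that psubset.prems(1) K(1) by (metis nsets2_iff subsetD)
      have w2: "2 \<le> w" unfolding w_def using card_mono[OF fin sub[OF K(2)]] c2[OF K(2)] by simp
      have ws: "w \<le> s" unfolding w_def using card_mono[OF fW] W by (metis Int_lower2)
      have "K \<subseteq> [\<Union>(clique_edges Q K) \<inter> W]\<^bsup>2\<^esup>" using sub c2 by (auto simp: nsets2_iff)
      then have "card K \<le> w choose 2"
        using card_mono[OF finite_imp_finite_nsets[OF fin]] by (metis card_nsets w_def)
      then have kw: "2 * int (card K) \<le> int w * (int w - 1)" unfolding two_choose[symmetric] by simp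
      have "(int w - 2) * (int s - int w) \<ge> 0" using w2 ws by simp
      then have "2 * int s - (int s + 1) * int w \<le> - 2 * int (card K)" using kw by (simp add: algebra_simps)
      then have "int (r choose 2) * (2 * int s - (int s + 1) * int w) \<le> int (r choose 2) * (- 2 * int (card K))"
        using choose_r_pos by (intro mult_left_mono) auto
      then have bd: "2 * int s * int (r choose 2) - vweight * int w \<le> - 2 * int (r choose 2) * int (card K)"
        unfolding vweight_eq by (simp add: algebra_simps)
      have "card (\<Union>(clique_edges Q K) - W) + w = card (\<Union>(clique_edges Q K))"
        unfolding w_def using cK(4) by (metis card_Diff_subset_Int card_Int_Diff add.commute)
      then have cw: "int (card (\<Union>(clique_edges Q K) - W)) = int (card (\<Union>(clique_edges Q K))) - int w" by linarith
      have DK: "D K = potential (clique_edges Q K) - vweight * int w" unfolding D_def potential_def cw by (simp add: algebra_simps)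
      have DK1: "D K \<le> - 2 * int (r choose 2) * int (card K)" using DK bd K(4) by linarith
      have DK2: "D K < - 2 * int (r choose 2) * int (card K)" if "card K \<ge> 2" using DK bd K(5)[OF that] by linarith
      have E: "card (clique_edges Q N) = card (clique_edges Q K) + card (clique_edges Q ?M)"
        unfolding clN using cK(1) cM(1) K(3) by (rule card_Un_disjoint)
      have V: "\<Union>(clique_edges Q N) - W = (\<Union>(clique_edges Q K) - W) \<union> (\<Union>(clique_edges Q ?M) - W)" unfolding clN by auto
      \<comment> \<open>\<open>i\<close> counts the vertices outside \<open>W\<close> that the class
        shares with the remaining cliques; each lowers the total by \<open>vweight\<close>.\<close>
      define i where "i = card ((\<Union>(clique_edges Q K) - W) \<inter> (\<Union>(clique_edges Q ?M) - W))"
      have "card (\<Union>(clique_edges Q N) - W) + i = card (\<Union>(clique_edges Q K) - W) + card (\<Union>(clique_edges Q ?M) - W)"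
        unfolding V i_def using cK(4) cM(4) by (subst card_Un_Int) auto
      then have V': "int (card (\<Union>(clique_edges Q N) - W)) = int (card (\<Union>(clique_edges Q K) - W)) + int (card (\<Union>(clique_edges Q ?M) - W)) - int i"
        by linarith
      have DN: "D N = D K + D ?M - vweight * int i" unfolding D_def V' E by (simp add: algebra_simps)
      have ci: "int (card N) = int (card K) + int (card ?M)"
        using card_Diff_subset[OF fK(1) K(1)] card_mono[OF psubset.hyps K(1)] by linarith
      have rhs: "- 2 * int (r choose 2) * int (card N) = - 2 * int (r choose 2) * int (card K) + - 2 * int (r choose 2) * int (card ?M)"
        unfolding ci by (simp add: algebra_simps)
      have vi: "vweight * int i \<ge> 0" using vweight_pos by simp
      have le: "D N \<le> - 2 * int (r choose 2) * int (card N)" using DN DK1 IH(1) rhs vi by linarith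
      moreover have "\<forall>f\<in>N. \<forall>g\<in>N. f \<noteq> g \<longrightarrow> Q f \<inter> Q g \<subseteq> W" if eq: "D N = - 2 * int (r choose 2) * int (card N)"
      proof -
        \<comment> \<open>Equality in the sum makes every summand tight: a class of two or more
          cliques would be strict, \<open>i\<close> must vanish, and the induction hypothesis for
          equality applies to the rest.\<close>
        have "\<not> card K \<ge> 2" using DK2 eq DN IH(1) rhs vi by linarith
        moreover have "card K \<noteq> 0" using K fK by auto
        ultimately have "card K = 1" by linarith
        then have K1: "K = {f0}" using K(2) by (metis card_1_singletonE singletonD)
        have "vweight * int i = 0" using eq DN DK1 IH(1) rhs vi by linarith
        then have "i = 0" using vweight_pos by simp
        then have dis: "(\<Union>(clique_edges Q K) - W) \<inter> (\<Union>(clique_edges Q ?M) - W) = {}" using cK(4) unfolding i_def by simp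
        have "D ?M = - 2 * int (r choose 2) * int (card ?M)" using eq DN DK1 IH(1) rhs vi by linarith
        then have ih: "\<forall>f\<in>?M. \<forall>g\<in>?M. f \<noteq> g \<longrightarrow> Q f \<inter> Q g \<subseteq> W" using IH(2) by blast
        have f0g: "Q f0 \<inter> Q g \<subseteq> W" if "g \<in> ?M" for g
        proof -
          have "Q f0 \<subseteq> \<Union>(clique_edges Q K)" "Q g \<subseteq> \<Union>(clique_edges Q ?M)" unfolding cK(3) cM(3) using that K(2) by auto
          then show ?thesis using dis by blast
        qed
        show ?thesis
        proof (intro ballI impI)
          fix f g assume fg: "f \<in> N" "g \<in> N" "f \<noteq> g"
          consider "f = f0" "g \<in> ?M" | "g = f0" "f \<in> ?M" | "f \<in> ?M" "g \<in> ?M" using fg K1 by blast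
          then show "Q f \<inter> Q g \<subseteq> W" using f0g ih fg(3) by cases (simp_all, blast)
        qed
      qed
      ultimately show ?thesis by blast
    qed
  qed
  then show "vweight * int (card (\<Union>(clique_edges Q N) - W)) - eweight * int (card (clique_edges Q N)) \<le> - 2 * int (r choose 2) * int (card N)"
    and "vweight * int (card (\<Union>(clique_edges Q N) - W)) - eweight * int (card (clique_edges Q N)) = - 2 * int (r choose 2) * int (card N)
      \<Longrightarrow> \<forall>f\<in>N. \<forall>g\<in>N. f \<noteq> g \<longrightarrow> Q f \<inter> Q g \<subseteq> W"
    unfolding D_def by auto
qed

text \<open>With \<open>t \<ge> 2\<close> vertices of \<open>W\<close> in \<open>S\<close>, the new
  vertices in \<open>W\<close> cost \<open>vweight * (s - t)\<close>, and by
  \<open>potential_outside\<close> the cliques repay at least \<open>2 * (r choose 2)\<close> for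
  each of the at least \<open>(s - t) * (s + t - 1) / 2\<close> edges of \<open>N\<close>. As
  \<open>vweight = (s + 1) * (r choose 2)\<close>, the balance is at most
  \<open>(r choose 2) * (s - t) * (2 - t) \<le> 0\<close>.\<close>

lemma potential_extend:
  assumes S: "finite S" "\<forall>e\<in>S. card e = 2"
    and W: "card W = s" and e: "e \<in> S" "e \<in> [W]\<^bsup>2\<^esup>" and new: "\<not> [W]\<^bsup>2\<^esup> \<subseteq> S"
    and N: "N = [W]\<^bsup>2\<^esup> - S" and Q: "\<forall>f\<in>N. card (Q f) = r" "\<forall>f\<in>N. Q f \<inter> W = f" "\<forall>f\<in>N. [Q f]\<^bsup>2\<^esup> \<inter> S = {}"
  shows "potential (S \<union> clique_edges Q N) \<le> potential S"
    and "potential (S \<union> clique_edges Q N) = potential S \<Longrightarrow> W \<inter> \<Union>S = e \<and> (\<forall>f\<in>N. Q f \<inter> \<Union>S \<subseteq> W) \<and>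
      (\<forall>f\<in>N. \<forall>g\<in>N. f \<noteq> g \<longrightarrow> Q f \<inter> Q g \<subseteq> W)"
proof -
  have fW: "finite W" using W s3 by (auto intro: card_ge_0_finite)
  have fN: "finite N" unfolding N using fW by (simp add: finite_imp_finite_nsets)
  have NW: "N \<subseteq> [W]\<^bsup>2\<^esup>" unfolding N by auto
  note c = clique_edges_props[OF fN Q(1)]
  have fV: "finite (\<Union>S)" using S by (rule finite_Union_edges)
  define D where "D = vweight * int (card (\<Union>(clique_edges Q N) - W)) - eweight * int (card (clique_edges Q N))"
  note po = potential_outside[OF W fN NW Q(1,2), folded D_def]
  define t where "t = card (W \<inter> \<Union>S)"
  have eW: "e \<subseteq> W \<inter> \<Union>S" "card e = 2" using e by (auto simp: nsets2_iff)
  have t2: "2 \<le> t" unfolding t_def using eW fW by (metis card_mono finite_Int)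
  have ts: "t \<le> s" unfolding t_def using fW W by (metis card_mono Int_lower1)
  have "N \<noteq> {}" using new N by auto
  then have N1: "card N \<ge> 1" using fN by (simp add: Suc_leI card_gt_0_iff)
  have "[W]\<^bsup>2\<^esup> \<inter> S \<subseteq> [W \<inter> \<Union>S]\<^bsup>2\<^esup>" by (auto simp: nsets2_iff)
  then have "card ([W]\<^bsup>2\<^esup> \<inter> S) \<le> t choose 2"
    using card_mono[OF finite_imp_finite_nsets[of "W \<inter> \<Union>S"]] fW by (metis card_nsets finite_Int t_def)
  moreover have "card N + card ([W]\<^bsup>2\<^esup> \<inter> S) = s choose 2"
    unfolding N using finite_imp_finite_nsets[OF fW] W by (metis card_Int_Diff card_nsets add.commute)
  ultimately have "int (s choose 2) - int (t choose 2) \<le> int (card N)" by linarith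
  then have "2 * int (s choose 2) - 2 * int (t choose 2) \<le> 2 * int (card N)" by linarith
  then have N2: "(int s - int t) * (int s + int t - 1) \<le> 2 * int (card N)"
    unfolding two_choose by (simp add: algebra_simps)
  have E: "card (S \<union> clique_edges Q N) = card S + card (clique_edges Q N)"
    using S c(1) Q(3) by (intro card_Un_disjoint) (auto simp: clique_edges_def)
  let ?X = "\<Union>S" and ?Y = "W - \<Union>S" and ?Z = "(\<Union>(clique_edges Q N) - W) - \<Union>S"
  have sub: "\<Union>(S \<union> clique_edges Q N) \<subseteq> ?X \<union> ?Y \<union> ?Z" by auto
  have "card (\<Union>(S \<union> clique_edges Q N)) \<le> card (?X \<union> ?Y \<union> ?Z)"
    using fV fW c(4) by (intro card_mono sub) auto
  also have "\<dots> \<le> card (?X \<union> ?Y) + card ?Z" by (rule card_Un_le)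
  also have "\<dots> \<le> card ?X + card ?Y + card ?Z" using card_Un_le[of ?X ?Y] by simp
  finally have V: "card (\<Union>(S \<union> clique_edges Q N)) \<le> card ?X + card ?Y + card ?Z" .
  have Y: "int (card ?Y) = int s - int t"
    using card_Int_Diff[OF fW, of "\<Union>S"] W unfolding t_def by linarith
  \<comment> \<open>These are the vertices of the cliques outside \<open>W\<close> that were already
    in \<open>S\<close>; any such vertex makes the inequality strict.\<close>
  define i where "i = card ((\<Union>(clique_edges Q N) - W) \<inter> \<Union>S)"
  have Z: "int (card ?Z) = int (card (\<Union>(clique_edges Q N) - W)) - int i"
    using card_Int_Diff[of "\<Union>(clique_edges Q N) - W" "\<Union>S"] c(4) unfolding i_def by simp
  have "int (card (\<Union>(S \<union> clique_edges Q N))) \<le> int (card ?X) + (int s - int t) + (int (card (\<Union>(clique_edges Q N) - W)) - int i)"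
    using V unfolding Y[symmetric] Z[symmetric] by linarith
  then have "vweight * int (card (\<Union>(S \<union> clique_edges Q N))) \<le> vweight * (int (card ?X) + (int s - int t) + (int (card (\<Union>(clique_edges Q N) - W)) - int i))"
    using vweight_pos by (intro mult_left_mono) auto
  then have P: "potential (S \<union> clique_edges Q N) - potential S \<le> vweight * (int s - int t) + D - vweight * int i"
    unfolding potential_def E D_def by (simp add: algebra_simps)
  have R: "vweight * (int s - int t) - 2 * int (r choose 2) * int (card N) \<le> int (r choose 2) * ((int s - int t) * (2 - int t))"
  proof -
    have "int (r choose 2) * ((int s - int t) * (int s + int t - 1)) \<le> int (r choose 2) * (2 * int (card N))"
      using N2 by (intro mult_left_mono) auto
    then show ?thesis unfolding vweight_eq by (simp add: algebra_simps)
  qed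
  have R0: "int (r choose 2) * ((int s - int t) * (2 - int t)) \<le> 0"
    using ts t2 by (intro mult_nonneg_nonpos mult_nonneg_nonpos) auto
  have vi: "vweight * int i \<ge> 0" using vweight_pos by simp
  show "potential (S \<union> clique_edges Q N) \<le> potential S" using P po(1) R R0 vi by linarith
  show "W \<inter> \<Union>S = e \<and> (\<forall>f\<in>N. Q f \<inter> \<Union>S \<subseteq> W) \<and> (\<forall>f\<in>N. \<forall>g\<in>N. f \<noteq> g \<longrightarrow> Q f \<inter> Q g \<subseteq> W)"
    if eq: "potential (S \<union> clique_edges Q N) = potential S"
  proof -
    have "vweight * int i = 0" using eq P po(1) R R0 vi by linarith
    then have "i = 0" using vweight_pos by simp
    then have "(\<Union>(clique_edges Q N) - W) \<inter> \<Union>S = {}" using c(4) unfolding i_def by simp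
    then have 2: "\<forall>f\<in>N. Q f \<inter> \<Union>S \<subseteq> W" unfolding c(3) by blast
    have "D = - 2 * int (r choose 2) * int (card N)" using eq P po(1) R R0 vi by linarith
    then have 3: "\<forall>f\<in>N. \<forall>g\<in>N. f \<noteq> g \<longrightarrow> Q f \<inter> Q g \<subseteq> W" by (rule po(2))
    \<comment> \<open>The bound also vanishes at \<open>t = s\<close>, but then \<open>W\<close> has
      no new vertex to pay for, while the nonempty \<open>N\<close> still lowers the
      potential.\<close>
    have "int s - int t \<noteq> 0"
    proof
      assume 0: "int s - int t = 0"
      have "int (r choose 2) * int (card N) > 0" using choose_r_pos N1 by simp
      then show False using eq P po(1) vi unfolding 0 by simp
    qed
    moreover have "int (r choose 2) * ((int s - int t) * (2 - int t)) = 0" using eq P po(1) R R0 vi by linarith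
    ultimately have "t = 2" using choose_r_pos by simp
    then have "W \<inter> \<Union>S = e" using eW fW card_subset_eq[of "W \<inter> \<Union>S" e] unfolding t_def by simp
    then show ?thesis using 2 3 by simp
  qed
qed

subsection \<open>Minimal families of cliques that cannot be hit\<close>

definition edge_union :: "'a set set \<Rightarrow> 'a set set" where
  "edge_union \<B> = clique_edges (\<lambda>Q. Q) \<B>"

definition clique_free :: "'a set set \<Rightarrow> bool" where
  "clique_free R \<longleftrightarrow> (\<forall>A. card A = s \<longrightarrow> \<not> [A]\<^bsup>2\<^esup> \<subseteq> R)"

definition hits :: "'a set set \<Rightarrow> 'a set set \<Rightarrow> bool" where
  "hits R \<B> \<longleftrightarrow> (\<forall>Q\<in>\<B>. [Q]\<^bsup>2\<^esup> \<inter> R \<noteq> {})"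

text \<open>\<open>R\<close> is the set of red edges.\<close>

definition colourable :: "'a set set \<Rightarrow> bool" where
  "colourable \<B> \<longleftrightarrow> (\<exists>R. clique_free R \<and> hits R \<B>)"

definition critical :: "'a set set \<Rightarrow> bool" where
  "critical \<B> \<longleftrightarrow> finite \<B> \<and> (\<forall>Q\<in>\<B>. card Q = r) \<and> \<not> colourable \<B> \<and> (\<forall>\<B>'. \<B>' \<subset> \<B> \<longrightarrow> colourable \<B>')"

text \<open>This is the shape of a K_s inside a minimal hitting set: each of its edges is there
  because some clique of the family is hit by no other edge.\<close>

definition linked :: "'a set set \<Rightarrow> 'a set \<Rightarrow> bool" where
  "linked \<B> A \<longleftrightarrow> card A = s \<and> (\<forall>f\<in>[A]\<^bsup>2\<^esup>. \<exists>Q\<in>\<B>. [Q]\<^bsup>2\<^esup> \<inter> [A]\<^bsup>2\<^esup> = {f})"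

lemma edge_union_eq: "edge_union \<B> = (\<Union>Q\<in>\<B>. [Q]\<^bsup>2\<^esup>)"
  by (simp add: edge_union_def clique_edges_def)

lemma edge_union_Un: "edge_union (\<A> \<union> \<B>) = edge_union \<A> \<union> edge_union \<B>"
  by (auto simp: edge_union_eq)

lemma edge_union_mono: "\<A> \<subseteq> \<B> \<Longrightarrow> edge_union \<A> \<subseteq> edge_union \<B>"
  unfolding edge_union_eq by (rule UN_mono) auto

lemma clique_subset_edge_union: "Q \<in> \<B> \<Longrightarrow> [Q]\<^bsup>2\<^esup> \<subseteq> edge_union \<B>"
  unfolding edge_union_eq by (rule UN_upper)

lemma edge_union_props:
  assumes "finite \<B>" "\<forall>Q\<in>\<B>. card Q = r"
  shows "finite (edge_union \<B>)" "\<forall>e\<in>edge_union \<B>. card e = 2" "\<Union>(edge_union \<B>) = \<Union>\<B>" "finite (\<Union>(edge_union \<B>))"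
  using clique_edges_props[OF assms] by (simp_all add: edge_union_def)

lemma clique_free_subset: "clique_free R \<Longrightarrow> R' \<subseteq> R \<Longrightarrow> clique_free R'"
  unfolding clique_free_def by (metis subset_trans)

lemma exists_critical:
  assumes "finite \<B>" "\<forall>Q\<in>\<B>. card Q = r" "\<not> colourable \<B>"
  shows "\<exists>\<C>\<subseteq>\<B>. critical \<C>"
  using assms
proof (induction rule: finite_psubset_induct)
  case (psubset \<B>)
  show ?case
  proof (cases "\<forall>\<B>'. \<B>' \<subset> \<B> \<longrightarrow> colourable \<B>'")
    case True
    then show ?thesis using psubset by (auto simp: critical_def)
  next
    case False
    then obtain \<B>' where B: "\<B>' \<subset> \<B>" "\<not> colourable \<B>'" by auto
    then have "\<forall>Q\<in>\<B>'. card Q = r" using psubset.prems by auto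
    then obtain \<C> where "\<C> \<subseteq> \<B>'" "critical \<C>" using psubset.IH B by blast
    then show ?thesis using B by auto
  qed
qed

text \<open>In a hitting set of least size every edge is the only red edge of some clique, since
  otherwise it could be dropped; dropping edges keeps the set K_s-free.\<close>

lemma minimal_hitting:
  assumes "finite \<B>" "\<forall>Q\<in>\<B>. card Q = r" "colourable \<B>"
  obtains R where "R \<subseteq> edge_union \<B>" "clique_free R" "hits R \<B>" "\<forall>f\<in>R. \<exists>Q\<in>\<B>. [Q]\<^bsup>2\<^esup> \<inter> R = {f}"
proof -
  obtain R0 where R0: "clique_free R0" "hits R0 \<B>" using assms(3) by (auto simp: colourable_def)
  define P where "P R \<longleftrightarrow> R \<subseteq> edge_union \<B> \<and> clique_free R \<and> hits R \<B>" for R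
  have "hits (R0 \<inter> edge_union \<B>) \<B>"
    unfolding hits_def
  proof
    fix Q assume Q: "Q \<in> \<B>"
    then obtain x where "x \<in> [Q]\<^bsup>2\<^esup>" "x \<in> R0" using R0(2) unfolding hits_def by blast
    then show "[Q]\<^bsup>2\<^esup> \<inter> (R0 \<inter> edge_union \<B>) \<noteq> {}" using clique_subset_edge_union[OF Q] by blast
  qed
  then have "P (R0 \<inter> edge_union \<B>)" using R0(1) clique_free_subset[of R0 "R0 \<inter> edge_union \<B>"] by (simp add: P_def)
  then obtain R where R: "P R" and mn: "\<And>R'. P R' \<Longrightarrow> card R \<le> card R'"
    using ex_has_least_nat[of P _ card] by blast
  have fR: "finite R" using R edge_union_props(1)[OF assms(1,2)] finite_subset by (auto simp: P_def)
  have "\<exists>Q\<in>\<B>. [Q]\<^bsup>2\<^esup> \<inter> R = {f}" if f: "f \<in> R" for f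
  proof (rule ccontr)
    assume no: "\<not> (\<exists>Q\<in>\<B>. [Q]\<^bsup>2\<^esup> \<inter> R = {f})"
    have "hits (R - {f}) \<B>"
      unfolding hits_def
    proof
      fix Q assume Q: "Q \<in> \<B>"
      have "[Q]\<^bsup>2\<^esup> \<inter> R \<noteq> {}" "[Q]\<^bsup>2\<^esup> \<inter> R \<noteq> {f}" using R Q no unfolding P_def hits_def by blast+
      then show "[Q]\<^bsup>2\<^esup> \<inter> (R - {f}) \<noteq> {}" by blast
    qed
    moreover have "clique_free (R - {f})" using R clique_free_subset[of R "R - {f}"] unfolding P_def by blast
    ultimately have "P (R - {f})" using R unfolding P_def by blast
    then have "card R \<le> card (R - {f})" by (rule mn)
    then show False using f fR by (metis card_Diff1_less not_le)
  qed
  then show ?thesis using that[of R] R unfolding P_def by blast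
qed

text \<open>Take a minimal \<open>R\<close> hitting all cliques but \<open>Q0\<close>. It misses
  \<open>Q0\<close>, and making \<open>e\<close> red as well would hit everything, so
  \<open>e\<close> completes a K_s whose other edges lie in \<open>R\<close>; this is
  \<open>A\<close>.\<close>

lemma critical_linked:
  assumes crit: "critical \<B>" and Q0: "Q0 \<in> \<B>" and e: "e \<in> [Q0]\<^bsup>2\<^esup>"
  obtains A where "linked \<B> A" "[A]\<^bsup>2\<^esup> \<inter> [Q0]\<^bsup>2\<^esup> = {e}"
proof -
  let ?B = "\<B> - {Q0}"
  have B: "finite ?B" "\<forall>Q\<in>?B. card Q = r" "\<not> colourable \<B>" using crit by (auto simp: critical_def)
  have "?B \<subset> \<B>" using Q0 by auto
  then have "colourable ?B" using crit by (simp add: critical_def)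
  then obtain R where R: "clique_free R" "hits R ?B" "\<forall>f\<in>R. \<exists>Q\<in>?B. [Q]\<^bsup>2\<^esup> \<inter> R = {f}"
    using minimal_hitting[OF B(1,2)] by metis
  have Q0R: "[Q0]\<^bsup>2\<^esup> \<inter> R = {}"
  proof (rule ccontr)
    assume "[Q0]\<^bsup>2\<^esup> \<inter> R \<noteq> {}"
    then have "hits R \<B>" using R(2) by (auto simp: hits_def)
    then show False using R(1) B(3) by (auto simp: colourable_def)
  qed
  have "hits (insert e R) \<B>"
    unfolding hits_def
  proof
    fix Q assume "Q \<in> \<B>"
    then show "[Q]\<^bsup>2\<^esup> \<inter> insert e R \<noteq> {}"
      using e R(2) by (cases "Q = Q0") (auto simp: hits_def)
  qed
  then have "\<not> clique_free (insert e R)" using B(3) by (auto simp: colourable_def)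
  then obtain A where A: "card A = s" "[A]\<^bsup>2\<^esup> \<subseteq> insert e R" by (auto simp: clique_free_def)
  have fA: "finite A" using A s3 by (auto intro: card_ge_0_finite)
  have eA: "e \<in> [A]\<^bsup>2\<^esup>"
  proof (rule ccontr)
    assume "e \<notin> [A]\<^bsup>2\<^esup>"
    then have "[A]\<^bsup>2\<^esup> \<subseteq> R" using A(2) by blast
    then show False using R(1) A(1) by (auto simp: clique_free_def)
  qed
  have AQ: "[A]\<^bsup>2\<^esup> \<inter> [Q0]\<^bsup>2\<^esup> = {e}" using eA e A(2) Q0R by blast
  have "\<exists>Q\<in>\<B>. [Q]\<^bsup>2\<^esup> \<inter> [A]\<^bsup>2\<^esup> = {f}" if f: "f \<in> [A]\<^bsup>2\<^esup>" for f
  proof (cases "f = e")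
    case True
    then show ?thesis using AQ Q0 by (intro bexI[of _ Q0]) (simp_all add: Int_commute)
  next
    case False
    then have "f \<in> R" using f A(2) by blast
    then obtain Q where Q: "Q \<in> ?B" "[Q]\<^bsup>2\<^esup> \<inter> R = {f}" using R(3) by blast
    have fQ: "f \<in> [Q]\<^bsup>2\<^esup>" using Q(2) by blast
    have sub: "[Q]\<^bsup>2\<^esup> \<inter> [A]\<^bsup>2\<^esup> \<subseteq> {e, f}" using Q(2) A(2) by blast
    \<comment> \<open>The witness for \<open>f\<close> is controlled only on \<open>R\<close>, so it
      might contain \<open>e\<close> too. It would then share three vertices with \<open>A\<close>,
      hence three pairs, while only \<open>e\<close> and \<open>f\<close> are available.\<close>
    have "e \<notin> [Q]\<^bsup>2\<^esup>"
    proof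
      assume eQ: "e \<in> [Q]\<^bsup>2\<^esup>"
      have sub2: "e \<subseteq> A \<inter> Q" "f \<subseteq> A \<inter> Q" "card e = 2" "card f = 2"
        using eQ fQ eA f by (auto simp: nsets2_iff)
      have fin: "finite (A \<inter> Q)" using fA by simp
      have "3 \<le> card (A \<inter> Q)" using three_le_card[OF fin sub2] False by simp
      then have "(3::nat) choose 2 \<le> card (A \<inter> Q) choose 2" by (rule binomial_right_mono)
      moreover have "card ([A \<inter> Q]\<^bsup>2\<^esup>) \<le> card {e, f}"
      proof (rule card_mono)
        have "[A \<inter> Q]\<^bsup>2\<^esup> \<subseteq> [Q]\<^bsup>2\<^esup> \<inter> [A]\<^bsup>2\<^esup>" by (simp add: nsets_mono)
        then show "[A \<inter> Q]\<^bsup>2\<^esup> \<subseteq> {e, f}" using sub by blast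
      qed simp
      moreover have "card {e, f} \<le> 2" by (simp add: card_insert_if)
      moreover have "(3::nat) choose 2 = 3" by (simp add: choose_two)
      ultimately show False by (simp add: card_nsets)
    qed
    then have "[Q]\<^bsup>2\<^esup> \<inter> [A]\<^bsup>2\<^esup> = {f}" using sub fQ f by blast
    then show ?thesis using Q(1) by blast
  qed
  then have "linked \<B> A" using A(1) by (simp add: linked_def)
  then show ?thesis using AQ that by blast
qed

text \<open>If the subfamily shares no edge with the remaining cliques, minimal hitting sets of both
  parts together hit everything, so their union contains a K_s. Neither set alone contains one, so
  this K_s uses edges of both. It is linked because a witness from one part contains no edge of the
  other.\<close>

lemma critical_escape:
  assumes crit: "critical \<B>" and S: "\<S> \<subset> \<B>" "\<S> \<noteq> {}"
    and closed: "\<And>Q. Q \<in> \<B> \<Longrightarrow> [Q]\<^bsup>2\<^esup> \<inter> edge_union \<S> \<noteq> {} \<Longrightarrow> Q \<in> \<S>"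
  obtains A where "linked \<B> A" "[A]\<^bsup>2\<^esup> \<inter> edge_union \<S> \<noteq> {}" "\<not> [A]\<^bsup>2\<^esup> \<subseteq> edge_union \<S>"
proof -
  let ?T = "\<B> - \<S>"
  have fin: "finite \<S>" "\<forall>Q\<in>\<S>. card Q = r" "finite ?T" "\<forall>Q\<in>?T. card Q = r"
    using crit S finite_subset[of \<S> \<B>] by (auto simp: critical_def)
  have "?T \<subset> \<B>" using S by auto
  then have col: "colourable \<S>" "colourable ?T" using crit S by (auto simp: critical_def)
  obtain R1 where R1: "R1 \<subseteq> edge_union \<S>" "clique_free R1" "hits R1 \<S>" "\<forall>f\<in>R1. \<exists>Q\<in>\<S>. [Q]\<^bsup>2\<^esup> \<inter> R1 = {f}"
    using minimal_hitting[OF fin(1,2) col(1)] by metis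
  \<comment> \<open>Here \<open>two_choose_r\<close> denotes a set, the hitting set of the
    complementary family, and not the identity of that name.\<close>
  obtain two_choose_r where two_choose_r: "two_choose_r \<subseteq> edge_union ?T" "clique_free two_choose_r" "hits two_choose_r ?T" "\<forall>f\<in>two_choose_r. \<exists>Q\<in>?T. [Q]\<^bsup>2\<^esup> \<inter> two_choose_r = {f}"
    using minimal_hitting[OF fin(3,4) col(2)] by metis
  have dis: "[Q]\<^bsup>2\<^esup> \<inter> edge_union \<S> = {}" if "Q \<in> ?T" for Q using closed[of Q] that by blast
  then have dis2: "edge_union ?T \<inter> edge_union \<S> = {}" unfolding edge_union_eq[of ?T] by blast
  have "hits (R1 \<union> two_choose_r) \<B>"
    unfolding hits_def
  proof
    fix Q assume "Q \<in> \<B>"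
    then show "[Q]\<^bsup>2\<^esup> \<inter> (R1 \<union> two_choose_r) \<noteq> {}"
      using R1(3) two_choose_r(3) by (cases "Q \<in> \<S>") (auto simp: hits_def)
  qed
  then have "\<not> clique_free (R1 \<union> two_choose_r)" using crit by (auto simp: colourable_def critical_def)
  then obtain A where A: "card A = s" "[A]\<^bsup>2\<^esup> \<subseteq> R1 \<union> two_choose_r" by (auto simp: clique_free_def)
  have "\<exists>Q\<in>\<B>. [Q]\<^bsup>2\<^esup> \<inter> [A]\<^bsup>2\<^esup> = {f}" if f: "f \<in> [A]\<^bsup>2\<^esup>" for f
  proof (cases "f \<in> R1")
    case True
    then obtain Q where Q: "Q \<in> \<S>" "[Q]\<^bsup>2\<^esup> \<inter> R1 = {f}" using R1(4) by blast
    have "[Q]\<^bsup>2\<^esup> \<inter> two_choose_r = {}" using clique_subset_edge_union[OF Q(1)] two_choose_r(1) dis2 by blast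
    then have "[Q]\<^bsup>2\<^esup> \<inter> [A]\<^bsup>2\<^esup> = {f}" using Q(2) A(2) f by blast
    then show ?thesis using Q(1) S by blast
  next
    case False
    then have "f \<in> two_choose_r" using f A(2) by blast
    then obtain Q where Q: "Q \<in> ?T" "[Q]\<^bsup>2\<^esup> \<inter> two_choose_r = {f}" using two_choose_r(4) by blast
    have "[Q]\<^bsup>2\<^esup> \<inter> R1 = {}" using dis[OF Q(1)] R1(1) by blast
    then have "[Q]\<^bsup>2\<^esup> \<inter> [A]\<^bsup>2\<^esup> = {f}" using Q(2) A(2) f by blast
    then show ?thesis using Q(1) S by blast
  qed
  then have 1: "linked \<B> A" using A(1) by (simp add: linked_def)
  have 2: "[A]\<^bsup>2\<^esup> \<inter> edge_union \<S> \<noteq> {}"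
  proof
    assume 0: "[A]\<^bsup>2\<^esup> \<inter> edge_union \<S> = {}"
    then have "[A]\<^bsup>2\<^esup> \<subseteq> two_choose_r" using A(2) R1(1) by blast
    then show False using two_choose_r(2) A(1) by (auto simp: clique_free_def)
  qed
  have 3: "\<not> [A]\<^bsup>2\<^esup> \<subseteq> edge_union \<S>"
  proof
    assume "[A]\<^bsup>2\<^esup> \<subseteq> edge_union \<S>"
    then have "[A]\<^bsup>2\<^esup> \<subseteq> R1" using A(2) two_choose_r(1) dis2 by blast
    then show False using R1(2) A(1) by (auto simp: clique_free_def)
  qed
  show ?thesis using that 1 2 3 by blast
qed

definition deg :: "'a set set \<Rightarrow> 'a \<Rightarrow> nat" where
  "deg S x = card {e\<in>S. x \<in> e}"

lemma deg_eq_nbrs: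
  assumes "\<forall>e\<in>S. card e = 2"
  shows "deg S x = card {y. y \<noteq> x \<and> {x, y} \<in> S}"
proof -
  have "{e\<in>S. x \<in> e} = (\<lambda>y. {x, y}) ` {y. y \<noteq> x \<and> {x, y} \<in> S}"
  proof (intro equalityI subsetI)
    fix e assume e: "e \<in> {e\<in>S. x \<in> e}"
    then have "card e = 2" using assms by auto
    then obtain u v where "e = {u, v}" "u \<noteq> v" unfolding card_2_iff by blast
    then have "\<exists>y. y \<noteq> x \<and> e = {x, y}" using e by (cases "x = u") auto
    then show "e \<in> (\<lambda>y. {x, y}) ` {y. y \<noteq> x \<and> {x, y} \<in> S}" using e by auto
  qed auto
  moreover have "inj_on (\<lambda>y. {x, y}) {y. y \<noteq> x \<and> {x, y} \<in> S}"
    by (auto simp: inj_on_def doubleton_eq_iff)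
  ultimately show ?thesis unfolding deg_def by (simp add: card_image)
qed

text \<open>Suppose \<open>x\<close> has at most \<open>r\<close> neighbours. Colour the cliques
  avoiding \<open>x\<close>, then make \<open>{x, u}\<close> and \<open>{x, w}\<close> red for two
  neighbours whose joining pair is not red. A clique through \<open>x\<close> contains
  \<open>r - 1\<close> of the at most \<open>r\<close> neighbours, hence \<open>u\<close> or
  \<open>w\<close>; a red K_s through \<open>x\<close> would need the pair \<open>{u, w}\<close>. So
  the whole family would be colourable.\<close>

lemma critical_degree:
  assumes crit: "critical \<B>" and x: "x \<in> \<Union>(edge_union \<B>)"
  shows "r + 1 \<le> deg (edge_union \<B>) x"
proof (rule ccontr)
  assume unsaturated: "\<not> r + 1 \<le> deg (edge_union \<B>) x"
  have B: "finite \<B>" "\<forall>Q\<in>\<B>. card Q = r" "\<not> colourable \<B>" using crit by (auto simp: critical_def)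
  note eB = edge_union_props[OF B(1,2)]
  define N where "N = {y. y \<noteq> x \<and> {x, y} \<in> edge_union \<B>}"
  have "N \<subseteq> \<Union>(edge_union \<B>)" by (auto simp: N_def)
  then have fN: "finite N" using eB(4) finite_subset by blast
  have Nr: "card N \<le> r" using unsaturated deg_eq_nbrs[OF eB(2)] unfolding N_def by simp
  have QN: "Q - {x} \<subseteq> N" if "Q \<in> \<B>" "x \<in> Q" for Q
  proof
    fix y assume y: "y \<in> Q - {x}"
    then have "{x, y} \<in> [Q]\<^bsup>2\<^esup>" using that by (auto simp: nsets2_iff card_2_iff)
    then show "y \<in> N" using clique_subset_edge_union[OF that(1)] y by (auto simp: N_def)
  qed
  obtain Q0 where Q0: "Q0 \<in> \<B>" "x \<in> Q0" using x eB(3) by auto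
  let ?B = "{Q\<in>\<B>. x \<notin> Q}"
  have fB: "finite ?B" "\<forall>Q\<in>?B. card Q = r" using B by auto
  have "?B \<subset> \<B>" using Q0 by auto
  then have "colourable ?B" using crit by (simp add: critical_def)
  then obtain R where R: "R \<subseteq> edge_union ?B" "clique_free R" "hits R ?B"
    using minimal_hitting[OF fB] by metis
  have Rx: "x \<notin> e" if "e \<in> R" for e
  proof -
    have "e \<subseteq> \<Union>?B" using that R(1) edge_union_props(3)[OF fB] by blast
    then show ?thesis by auto
  qed
  have "card (Q0 - {x}) = r - 1" using Q0 B(2) r_set(1)[of Q0] by simp
  then have "r - 1 \<le> card N" using card_mono[OF fN QN[OF Q0]] by simp
  then have "s \<le> card N" using sr by linarith
  \<comment> \<open>A set of \<open>s\<close> neighbours cannot be completely red, which provides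
    the pair \<open>{u, w}\<close>.\<close>
  then obtain A where A: "A \<subseteq> N" "card A = s" by (metis obtain_subset_with_card_n)
  then have "\<not> [A]\<^bsup>2\<^esup> \<subseteq> R" using R(2) by (auto simp: clique_free_def)
  then obtain e where "e \<in> [A]\<^bsup>2\<^esup>" and e3: "e \<notin> R" by blast
  then have e: "e \<subseteq> A" "card e = 2" by (simp_all add: nsets2_iff)
  then obtain u w where uw: "e = {u, w}" "u \<noteq> w" unfolding card_2_iff by blast
  then have uwN: "u \<in> N" "w \<in> N" "{u, w} \<notin> R" using e e3 A by auto
  then have ux: "u \<noteq> x" "w \<noteq> x" by (auto simp: N_def)
  let ?R = "R \<union> {{x, u}, {x, w}}"
  have "clique_free ?R"
    unfolding clique_free_def
  proof (intro allI impI notI)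
    fix A assume A: "card A = s" "[A]\<^bsup>2\<^esup> \<subseteq> ?R"
    have fA: "finite A" using A s3 by (auto intro: card_ge_0_finite)
    show False
    proof (cases "x \<in> A")
      case True
      have "A \<subseteq> {x, u, w}"
      proof
        fix y assume y: "y \<in> A"
        show "y \<in> {x, u, w}"
        proof (cases "y = x")
          case False
          then have "{x, y} \<in> [A]\<^bsup>2\<^esup>" using True y by (simp add: nsets2_iff)
          then have "{x, y} \<in> ?R" using A(2) by blast
          then have "{x, y} = {x, u} \<or> {x, y} = {x, w}" using Rx[of "{x, y}"] by blast
          then show ?thesis by (auto simp: doubleton_eq_iff)
        qed simp
      qed
      moreover have "card {x, u, w} = 3" using uw(2) ux by auto
      ultimately have "A = {x, u, w}" using A(1) s3 by (intro card_seteq) auto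
      then have "{u, w} \<in> [A]\<^bsup>2\<^esup>" using uw(2) by (simp add: nsets2_iff)
      then have "{u, w} \<in> ?R" using A(2) by blast
      then show False using uwN(3) ux by (auto simp: doubleton_eq_iff)
    next
      case False
      have "[A]\<^bsup>2\<^esup> \<subseteq> R"
      proof
        fix e assume e: "e \<in> [A]\<^bsup>2\<^esup>"
        then have "x \<notin> e" using False by (auto simp: nsets2_iff)
        then show "e \<in> R" using A(2) e by blast
      qed
      then show False using R(2) A(1) by (auto simp: clique_free_def)
    qed
  qed
  moreover have "hits ?R \<B>"
    unfolding hits_def
  proof
    fix Q assume Q: "Q \<in> \<B>"
    show "[Q]\<^bsup>2\<^esup> \<inter> ?R \<noteq> {}"
    proof (cases "x \<in> Q")
      case True
      have "u \<in> Q \<or> w \<in> Q"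
      proof (rule ccontr)
        assume no: "\<not> (u \<in> Q \<or> w \<in> Q)"
        then have "Q - {x} \<subseteq> N - {u, w}" using QN[OF Q True] by blast
        then have "card (Q - {x}) \<le> card (N - {u, w})" using fN by (intro card_mono) auto
        moreover have "card (Q - {x}) = r - 1" using Q True B(2) r_set(1)[of Q] by simp
        moreover have "card (N - {u, w}) = card N - 2" using uwN uw(2) fN by (simp add: card_Diff_subset)
        ultimately show False using Nr sr s3 by linarith
      qed
      then show ?thesis
      proof
        assume "u \<in> Q"
        then have "{x, u} \<in> [Q]\<^bsup>2\<^esup>" using True ux by (simp add: nsets2_iff)
        then show ?thesis by blast
      next
        assume "w \<in> Q"
        then have "{x, w} \<in> [Q]\<^bsup>2\<^esup>" using True ux by (simp add: nsets2_iff)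
        then show ?thesis by blast
      qed
    next
      case False
      then show ?thesis using R(3) Q by (auto simp: hits_def)
    qed
  qed
  ultimately show False using B(3) by (auto simp: colourable_def)
qed

subsection \<open>Exploration steps\<close>

text \<open>
  In the union of a critical family all degrees exceed \<open>r\<close>, so a vertex of degree below \<open>r\<close>
  indicates where the exploration has to continue.
\<close>

definition unsaturated :: "'a set set \<Rightarrow> bool" where
  "unsaturated S \<longleftrightarrow> (\<exists>x\<in>\<Union>S. deg S x < r)"

text \<open>The choice depends on \<open>S\<close> alone and not on the critical family, so that in
  the counting it fixes where the next step attaches.\<close>

definition pick :: "'a set set \<Rightarrow> 'a set" where
  "pick S = (SOME e. e \<in> S \<and> (\<exists>x\<in>e. deg S x < r))"

text \<open>A step adds at most \<open>s choose 2\<close> cliques with \<open>r\<close> vertices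
  each.\<close>

definition ext_size :: nat where "ext_size = r * (s choose 2)"

text \<open>Only what the counting uses is recorded, without reference to a critical family, so that
  the possible successors of a given graph can be enumerated. A step that keeps the potential has to
  produce an unsaturated graph, and from an unsaturated graph it has to attach inside the picked
  edge.\<close>

definition child :: "'a set set \<Rightarrow> 'a set set \<Rightarrow> bool" where
  "child S S' \<longleftrightarrow> S \<subset> S' \<and> card (\<Union>(S' - S)) \<le> ext_size \<and>
     (potential S' < potential S \<or> potential S' \<le> potential S \<and> unsaturated S' \<and> (unsaturated S \<longrightarrow> \<Union>(S' - S) \<inter> \<Union>S \<subseteq> pick S))"

lemma r_le_ext_size: "r \<le> ext_size"
proof -
  have "1 \<le> s choose 2" using s3 by (simp add: Suc_leI)
  then show ?thesis unfolding ext_size_def by simp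
qed

text \<open>The added cliques are those certifying that \<open>A\<close> is linked, taken for the
  edges of \<open>A\<close> outside \<open>\<S>\<close>. By \<open>closed\<close> none of them
  shares an edge with \<open>\<S>\<close>, since it would then be covered together with its edge of
  \<open>A\<close>; hence \<open>potential_extend\<close> applies.\<close>

lemma extend_step:
  assumes crit: "critical \<B>" and S: "\<S> \<subseteq> \<B>"
    and closed: "\<And>Q. Q \<in> \<B> \<Longrightarrow> [Q]\<^bsup>2\<^esup> \<inter> edge_union \<S> \<noteq> {} \<Longrightarrow> [Q]\<^bsup>2\<^esup> \<subseteq> edge_union \<S>"
    and A: "linked \<B> A" and e: "e \<in> [A]\<^bsup>2\<^esup>" "e \<in> edge_union \<S>" and new: "\<not> [A]\<^bsup>2\<^esup> \<subseteq> edge_union \<S>"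
  obtains \<S>' where "\<S> \<subseteq> \<S>'" "\<S>' \<subseteq> \<B>" "edge_union \<S> \<subset> edge_union \<S>'" "card (\<Union>(edge_union \<S>' - edge_union \<S>)) \<le> ext_size"
    "potential (edge_union \<S>') \<le> potential (edge_union \<S>)"
    "potential (edge_union \<S>') = potential (edge_union \<S>) \<Longrightarrow> unsaturated (edge_union \<S>') \<and> \<Union>(edge_union \<S>' - edge_union \<S>) \<inter> \<Union>(edge_union \<S>) \<subseteq> e"
proof -
  have B: "finite \<B>" "\<forall>Q\<in>\<B>. card Q = r" using crit by (auto simp: critical_def)
  have fS: "finite \<S>" "\<forall>Q\<in>\<S>. card Q = r" using B S finite_subset by auto
  note eS = edge_union_props[OF fS]
  have cA: "card A = s" using A by (simp add: linked_def)
  then have fA: "finite A" using s3 by (auto intro: card_ge_0_finite)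
  define N where "N = [A]\<^bsup>2\<^esup> - edge_union \<S>"
  define S where "S = edge_union \<S>"
  have fN: "finite N" unfolding N_def using fA by (simp add: finite_imp_finite_nsets)
  have "\<forall>f\<in>[A]\<^bsup>2\<^esup>. \<exists>Q. Q \<in> \<B> \<and> [Q]\<^bsup>2\<^esup> \<inter> [A]\<^bsup>2\<^esup> = {f}" using A by (auto simp: linked_def)
  then obtain Q where Q: "\<And>f. f \<in> [A]\<^bsup>2\<^esup> \<Longrightarrow> Q f \<in> \<B>" "\<And>f. f \<in> [A]\<^bsup>2\<^esup> \<Longrightarrow> [Q f]\<^bsup>2\<^esup> \<inter> [A]\<^bsup>2\<^esup> = {f}"
    by metis
  have NA: "f \<in> [A]\<^bsup>2\<^esup>" "f \<notin> S" if "f \<in> N" for f using that by (auto simp: N_def S_def)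
  have Q1: "\<forall>f\<in>N. card (Q f) = r" using Q(1) NA(1) B(2) by blast
  have Q2: "\<forall>f\<in>N. Q f \<inter> A = f" using inter_of_single_common_edge[OF Q(2)] NA(1) by blast
  have fQ: "f \<in> [Q f]\<^bsup>2\<^esup>" if "f \<in> N" for f using Q(2)[OF NA(1)[OF that]] by blast
  have Q3: "\<forall>f\<in>N. [Q f]\<^bsup>2\<^esup> \<inter> S = {}"
  proof
    fix f assume f: "f \<in> N"
    show "[Q f]\<^bsup>2\<^esup> \<inter> S = {}"
    proof (rule ccontr)
      assume "[Q f]\<^bsup>2\<^esup> \<inter> S \<noteq> {}"
      then have "[Q f]\<^bsup>2\<^esup> \<subseteq> S" using closed[OF Q(1)[OF NA(1)[OF f]]] unfolding S_def by blast
      then show False using fQ[OF f] NA(2)[OF f] by blast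
    qed
  qed
  define T where "T = \<S> \<union> Q ` N"
  have eT: "edge_union T = S \<union> clique_edges Q N"
    unfolding T_def edge_union_Un S_def by (simp add: edge_union_def clique_edges_def)
  have TB: "T \<subseteq> \<B>" unfolding T_def using S Q(1) NA(1) by auto
  have "N \<noteq> {}" using new by (auto simp: N_def)
  then obtain f0 where f0: "f0 \<in> N" by auto
  have clf: "[Q f]\<^bsup>2\<^esup> \<subseteq> clique_edges Q N" if "f \<in> N" for f using that by (auto simp: clique_edges_def)
  have ss: "S \<subset> edge_union T" using f0 NA(2) clf[OF f0] fQ[OF f0] unfolding eT by blast
  have clS: "clique_edges Q N \<inter> S = {}" using Q3 unfolding clique_edges_def by auto
  then have dif: "edge_union T - S = clique_edges Q N" unfolding eT by blast
  note c = clique_edges_props[OF fN Q1]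
  have "card (\<Union>(clique_edges Q N)) \<le> (\<Sum>f\<in>N. card (Q f))" unfolding c(3) by (rule card_UN_le[OF fN])
  also have "\<dots> = card N * r" using Q1 by simp
  also have "\<dots> \<le> (s choose 2) * r"
  proof -
    have "card N \<le> card ([A]\<^bsup>2\<^esup>)" unfolding N_def using fA by (intro card_mono) (auto simp: finite_imp_finite_nsets)
    then show ?thesis using cA by (simp add: card_nsets)
  qed
  finally have K: "card (\<Union>(edge_union T - S)) \<le> ext_size" unfolding dif ext_size_def by (simp add: mult.commute)
  have S12: "finite S" "\<forall>e\<in>S. card e = 2" using eS by (simp_all add: S_def)
  have eS': "e \<in> S" "\<not> [A]\<^bsup>2\<^esup> \<subseteq> S" "N = [A]\<^bsup>2\<^esup> - S" using e new by (simp_all add: S_def N_def)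
  note pe = potential_extend[OF S12 cA eS'(1) e(1) eS'(2,3) Q1 Q2 Q3]
  have eq: "unsaturated (edge_union T) \<and> \<Union>(edge_union T - S) \<inter> \<Union>S \<subseteq> e" if "potential (edge_union T) = potential S"
  proof -
    have p: "A \<inter> \<Union>S = e" "\<forall>f\<in>N. Q f \<inter> \<Union>S \<subseteq> A" "\<forall>f\<in>N. \<forall>g\<in>N. f \<noteq> g \<longrightarrow> Q f \<inter> Q g \<subseteq> A"
      using pe(2) that unfolding eT by auto
    have "\<Union>(edge_union T - S) \<inter> \<Union>S \<subseteq> A \<inter> \<Union>S" unfolding dif c(3) using p(2) by blast
    then have 1: "\<Union>(edge_union T - S) \<inter> \<Union>S \<subseteq> e" using p(1) by simp
    have cf: "card f0 = 2" "f0 \<subseteq> A" using NA(1)[OF f0] by (simp_all add: nsets2_iff)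
    have cQ: "card (Q f0) = r" using Q1 f0 by blast
    \<comment> \<open>In the case of equality a vertex \<open>z\<close> of \<open>Q f0\<close>
      outside \<open>A\<close> is new and lies in no other added clique, so its degree is below
      \<open>r\<close>.\<close>
    have "\<not> Q f0 \<subseteq> A"
    proof
      assume "Q f0 \<subseteq> A"
      then have "Q f0 = f0" using Q2 f0 by blast
      then show False using cf cQ s3 sr by simp
    qed
    then obtain z where z: "z \<in> Q f0" "z \<notin> A" by blast
    have zS: "z \<notin> \<Union>S" using p(2) f0 z by blast
    have zT: "z \<in> \<Union>(edge_union T)" using z(1) f0 c(3) unfolding eT by auto
    have e2: "\<forall>e\<in>edge_union T. card e = 2" using S12 c(2) unfolding eT by auto
    have "{y. y \<noteq> z \<and> {z, y} \<in> edge_union T} \<subseteq> Q f0 - {z}"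
    proof
      fix y assume y: "y \<in> {y. y \<noteq> z \<and> {z, y} \<in> edge_union T}"
      then have "{z, y} \<notin> S" using zS by blast
      then have "{z, y} \<in> clique_edges Q N" using y unfolding eT by blast
      then obtain g where g: "g \<in> N" "{z, y} \<in> [Q g]\<^bsup>2\<^esup>" by (auto simp: clique_edges_def)
      then have "z \<in> Q g" "y \<in> Q g" by (auto simp: nsets2_iff)
      moreover have "g = f0" using p(3) g(1) f0 z \<open>z \<in> Q g\<close> by blast
      ultimately show "y \<in> Q f0 - {z}" using y by blast
    qed
    then have "card {y. y \<noteq> z \<and> {z, y} \<in> edge_union T} \<le> card (Q f0 - {z})"
      using r_set(1)[OF cQ] by (intro card_mono) auto
    also have "\<dots> < r" using z(1) cQ r_set(1)[OF cQ] sr by simp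
    finally have "deg (edge_union T) z < r" using deg_eq_nbrs[OF e2] by simp
    then show ?thesis using 1 zT by (auto simp: unsaturated_def)
  qed
  show ?thesis
  proof (rule that[of T])
    show "\<S> \<subseteq> T" by (simp add: T_def)
    show "potential (edge_union T) \<le> potential (edge_union \<S>)" using pe(1) unfolding eT S_def .
  qed (use TB ss K eq in \<open>simp_all add: S_def\<close>)
qed

text \<open>Three cases: a partly covered clique of \<open>\<B>\<close> is added; otherwise an
  unsaturated graph is extended at the picked edge by \<open>critical_linked\<close>; otherwise
  \<open>critical_escape\<close> provides a K_s leaving the graph.\<close>

lemma child_exists:
  assumes crit: "critical \<B>" and S: "\<S> \<subseteq> \<B>" "\<S> \<noteq> {}" and ne: "edge_union \<S> \<noteq> edge_union \<B>"
  obtains \<S>' where "\<S>' \<subseteq> \<B>" "\<S>' \<noteq> {}" "child (edge_union \<S>) (edge_union \<S>')"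
proof -
  have B: "finite \<B>" "\<forall>Q\<in>\<B>. card Q = r" using crit by (auto simp: critical_def)
  have fS: "finite \<S>" "\<forall>Q\<in>\<S>. card Q = r" using B S finite_subset by auto
  note eS = edge_union_props[OF fS] and obt = that
  show ?thesis
  proof (cases "\<exists>Q\<in>\<B>. [Q]\<^bsup>2\<^esup> \<inter> edge_union \<S> \<noteq> {} \<and> \<not> [Q]\<^bsup>2\<^esup> \<subseteq> edge_union \<S>")
    case True
    then obtain Q where Q: "Q \<in> \<B>" "[Q]\<^bsup>2\<^esup> \<inter> edge_union \<S> \<noteq> {}" "\<not> [Q]\<^bsup>2\<^esup> \<subseteq> edge_union \<S>" by blast
    have cQ: "card Q = r" using Q(1) B(2) by blast
    have eT: "edge_union (insert Q \<S>) = edge_union \<S> \<union> [Q]\<^bsup>2\<^esup>" by (auto simp: edge_union_eq)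
    have "\<Union>(edge_union (insert Q \<S>) - edge_union \<S>) \<subseteq> Q" unfolding eT by (auto simp: nsets2_iff)
    then have "card (\<Union>(edge_union (insert Q \<S>) - edge_union \<S>)) \<le> ext_size"
      using card_mono[OF r_set(1)[OF cQ]] cQ r_le_ext_size by (metis le_trans)
    moreover have "potential (edge_union (insert Q \<S>)) < potential (edge_union \<S>)"
      unfolding eT using potential_add_clique[OF eS(1,2) cQ Q(2,3)] .
    moreover have "edge_union \<S> \<subset> edge_union (insert Q \<S>)" unfolding eT using Q(3) by blast
    ultimately have "child (edge_union \<S>) (edge_union (insert Q \<S>))" by (simp add: child_def)
    then show ?thesis using that[of "insert Q \<S>"] Q(1) S by blast
  next
    case False
    then have closed: "\<And>Q. Q \<in> \<B> \<Longrightarrow> [Q]\<^bsup>2\<^esup> \<inter> edge_union \<S> \<noteq> {} \<Longrightarrow> [Q]\<^bsup>2\<^esup> \<subseteq> edge_union \<S>" by blast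
    have main: ?thesis if A: "linked \<B> A" "e \<in> [A]\<^bsup>2\<^esup>" "e \<in> edge_union \<S>" "\<not> [A]\<^bsup>2\<^esup> \<subseteq> edge_union \<S>"
      and pk: "unsaturated (edge_union \<S>) \<Longrightarrow> e = pick (edge_union \<S>)" for A e
    proof -
      obtain \<S>' where S': "\<S> \<subseteq> \<S>'" "\<S>' \<subseteq> \<B>" "edge_union \<S> \<subset> edge_union \<S>'" "card (\<Union>(edge_union \<S>' - edge_union \<S>)) \<le> ext_size"
        "potential (edge_union \<S>') \<le> potential (edge_union \<S>)"
        "potential (edge_union \<S>') = potential (edge_union \<S>) \<Longrightarrow> unsaturated (edge_union \<S>') \<and> \<Union>(edge_union \<S>' - edge_union \<S>) \<inter> \<Union>(edge_union \<S>) \<subseteq> e"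
        using extend_step[OF crit S(1) closed A] by blast
      have "child (edge_union \<S>) (edge_union \<S>')"
        unfolding child_def using S' pk by (cases "potential (edge_union \<S>') = potential (edge_union \<S>)") auto
      then show ?thesis using obt[of \<S>'] S' S by blast
    qed
    show ?thesis
    proof (cases "unsaturated (edge_union \<S>)")
      case True
      define e where "e = pick (edge_union \<S>)"
      have "\<exists>e. e \<in> edge_union \<S> \<and> (\<exists>x\<in>e. deg (edge_union \<S>) x < r)" using True by (auto simp: unsaturated_def)
      then have "e \<in> edge_union \<S> \<and> (\<exists>x\<in>e. deg (edge_union \<S>) x < r)" unfolding e_def pick_def by (rule someI_ex)
      then obtain x where e: "e \<in> edge_union \<S>" "x \<in> e" "deg (edge_union \<S>) x < r" by blast
      obtain Q where Q: "Q \<in> \<S>" "e \<in> [Q]\<^bsup>2\<^esup>" using e(1) by (auto simp: edge_union_eq)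
      have QB: "Q \<in> \<B>" using Q S by blast
      obtain A where A: "linked \<B> A" "[A]\<^bsup>2\<^esup> \<inter> [Q]\<^bsup>2\<^esup> = {e}" using critical_linked[OF crit QB Q(2)] .
      have eA: "e \<in> [A]\<^bsup>2\<^esup>" using A(2) by blast
      have AQ: "A \<inter> Q = e" using inter_of_single_common_edge[OF A(2)] .
      have cA: "card A = s" using A(1) by (simp add: linked_def)
      then have fA: "finite A" using s3 by (auto intro: card_ge_0_finite)
      have ce: "card e = 2" "e \<subseteq> Q" "e \<subseteq> A" using Q(2) eA by (auto simp: nsets2_iff)
      have "\<not> A \<subseteq> e"
      proof
        assume "A \<subseteq> e"
        then have "A = e" using ce by blast
        then show False using ce cA s3 by simp
      qed
      then obtain z where z: "z \<in> A" "z \<notin> Q" using AQ by blast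
      have cQ: "card Q = r" using Q(1) fS(2) by blast
      \<comment> \<open>The low-degree end \<open>x\<close> of the picked edge already has
        \<open>r - 1\<close> neighbours in \<open>Q\<close>. If \<open>A\<close> were covered, a
        vertex \<open>z\<close> of \<open>A\<close> outside \<open>Q\<close> would be one
        more.\<close>
      have "\<not> [A]\<^bsup>2\<^esup> \<subseteq> edge_union \<S>"
      proof
        assume sub: "[A]\<^bsup>2\<^esup> \<subseteq> edge_union \<S>"
        have "x \<in> A" "x \<in> Q" using e(2) ce by auto
        then have xz: "x \<noteq> z" using z by auto
        have "{x, z} \<in> [A]\<^bsup>2\<^esup>" using \<open>x \<in> A\<close> z xz by (simp add: nsets2_iff)
        then have 1: "{x, z} \<in> edge_union \<S>" using sub by blast
        have 2: "{x, y} \<in> edge_union \<S>" if "y \<in> Q" "y \<noteq> x" for y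
        proof -
          have "{x, y} \<in> [Q]\<^bsup>2\<^esup>" using \<open>x \<in> Q\<close> that by (auto simp: nsets2_iff card_2_iff)
          then show ?thesis using clique_subset_edge_union[OF Q(1)] by blast
        qed
        have "insert z (Q - {x}) \<subseteq> {y. y \<noteq> x \<and> {x, y} \<in> edge_union \<S>}" using 1 2 xz by auto
        moreover have "finite {y. y \<noteq> x \<and> {x, y} \<in> edge_union \<S>}"
          by (rule finite_subset[OF _ eS(4)]) auto
        ultimately have "card (insert z (Q - {x})) \<le> deg (edge_union \<S>) x"
          unfolding deg_eq_nbrs[OF eS(2)] by (rule card_mono[rotated])
        moreover have "card (insert z (Q - {x})) = r"
          using z cQ r_set(1)[OF cQ] \<open>x \<in> Q\<close> s3 sr by simp
        ultimately show False using e(3) by simp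
      qed
      then show ?thesis using main[OF A(1) eA e(1)] e_def by blast
    next
      case False
      \<comment> \<open>Cliques that are covered without being listed are included first. This keeps
        the union of edges and gives the closure that \<open>critical_escape\<close>
        requires.\<close>
      define \<S>1 where "\<S>1 = {Q\<in>\<B>. [Q]\<^bsup>2\<^esup> \<subseteq> edge_union \<S>}"
      have e1: "edge_union \<S>1 = edge_union \<S>"
      proof
        show "edge_union \<S>1 \<subseteq> edge_union \<S>" unfolding edge_union_eq[of \<S>1] by (rule UN_least) (simp add: \<S>1_def)
        have "\<S> \<subseteq> \<S>1" using S(1) clique_subset_edge_union by (auto simp: \<S>1_def)
        then show "edge_union \<S> \<subseteq> edge_union \<S>1" by (rule edge_union_mono)
      qed
      have "\<S>1 \<subseteq> \<B>" "\<S>1 \<noteq> \<B>" using ne e1 by (auto simp: \<S>1_def)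
      then have sub: "\<S>1 \<subset> \<B>" by blast
      have "\<S>1 \<noteq> {}" using S clique_subset_edge_union by (fastforce simp: \<S>1_def)
      moreover have "Q \<in> \<S>1" if "Q \<in> \<B>" "[Q]\<^bsup>2\<^esup> \<inter> edge_union \<S>1 \<noteq> {}" for Q
        using that closed e1 unfolding \<S>1_def by blast
      ultimately obtain A where A: "linked \<B> A" "[A]\<^bsup>2\<^esup> \<inter> edge_union \<S> \<noteq> {}" "\<not> [A]\<^bsup>2\<^esup> \<subseteq> edge_union \<S>"
        using critical_escape[OF crit sub] unfolding e1 by metis
      then obtain e where "e \<in> [A]\<^bsup>2\<^esup>" "e \<in> edge_union \<S>" by blast
      then show ?thesis using main[OF A(1)] A(3) False by blast
    qed
  qed
qed

end

subsection \<open>Counting\<close>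

lemma nsets2_subsetD:
  assumes "D \<subseteq> [V]\<^bsup>2\<^esup>"
  shows "\<Union>D \<subseteq> V" "D \<subseteq> [\<Union>D]\<^bsup>2\<^esup>" "\<forall>e\<in>D. card e = 2"
proof -
  have *: "e \<subseteq> V" "card e = 2" if "e \<in> D" for e using assms that nsets2_iff[of e V] by blast+
  show "\<Union>D \<subseteq> V" using *(1) by (rule Union_least)
  show "\<forall>e\<in>D. card e = 2" using *(2) by blast
  then show "D \<subseteq> [\<Union>D]\<^bsup>2\<^esup>" by (metis Union_upper nsets2_iff subsetI)
qed

lemma card_subsets_le_power:
  assumes "finite A"
  shows "card {B. B \<subseteq> A \<and> card B = k} \<le> card A ^ k"
proof -
  have "card {B. B \<subseteq> A \<and> card B = k} = card A choose k" using n_subsets[OF assms] by simp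
  also have "\<dots> \<le> card A ^ k"
    by (cases "k \<le> card A") (auto simp: binomial_le_pow binomial_eq_0)
  finally show ?thesis .
qed

lemma card_small_subsets_le_power:
  assumes "finite A"
  shows "card {B. B \<subseteq> A \<and> card B \<le> k} \<le> (card A + 1) ^ k"
proof -
  \<comment> \<open>A set of at most \<open>k\<close> elements is listed and padded with
    \<open>None\<close> to length exactly \<open>k\<close>.\<close>
  let ?L = "{xs. set xs \<subseteq> insert None (Some ` A) \<and> length xs = k}"
  have fin: "finite ?L" using assms by (intro finite_lists_length_eq) auto
  have "{B. B \<subseteq> A \<and> card B \<le> k} \<subseteq> (\<lambda>xs. Some -` set xs) ` ?L"
  proof
    fix B assume "B \<in> {B. B \<subseteq> A \<and> card B \<le> k}"
    then have B: "B \<subseteq> A" "card B \<le> k" by auto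
    obtain xs where xs: "set xs = B" "distinct xs"
      using finite_distinct_list finite_subset[OF B(1) assms] by metis
    let ?ys = "map Some xs @ replicate (k - card B) None"
    have "length ?ys = k" using xs B(2) distinct_card[OF xs(2)] by simp
    moreover have "set ?ys \<subseteq> insert None (Some ` A)" using xs B(1) by auto
    moreover have "Some -` set ?ys = B" using xs by auto
    ultimately show "B \<in> (\<lambda>xs. Some -` set xs) ` ?L" by blast
  qed
  then have "card {B. B \<subseteq> A \<and> card B \<le> k} \<le> card ?L" using fin by (rule surj_card_le[rotated])
  also have "\<dots> = card (insert None (Some ` A)) ^ k" using assms by (intro card_lists_length_eq) auto
  also have "\<dots> = (card A + 1) ^ k" using assms by (simp add: card_insert_if card_image)
  finally show ?thesis .
qed

text \<open>\<open>D\<close> is determined by its \<open>k\<close> vertices outside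
  \<open>X\<close>, its vertices in \<open>B\<close>, and a set of pairs on these at most
  \<open>K\<close> vertices. Only the first choice depends on \<open>V\<close>.\<close>

lemma card_extensions_le:
  assumes V: "finite V" and B: "finite B"
  shows "card {D. D \<subseteq> [V]\<^bsup>2\<^esup> \<and> card (\<Union>D) \<le> K \<and> \<Union>D \<inter> X \<subseteq> B \<and> card (\<Union>D - X) = k}
    \<le> card V ^ k * (card B + 1) ^ K * 2 ^ (K * K)" (is "card ?D \<le> _")
proof -
  let ?Y = "{Y. Y \<subseteq> V \<and> card Y = k}" and ?Z = "{Z. Z \<subseteq> B \<and> card Z \<le> K}"
  let ?F = "\<lambda>Y Z. if finite (Y \<union> Z) \<and> card (Y \<union> Z) \<le> K then Pow ([Y \<union> Z]\<^bsup>2\<^esup>) else {}"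
  have fY: "finite ?Y" and fZ: "finite ?Z" using V B by auto
  have fF: "finite (?F Y Z)" for Y Z by (auto intro: finite_imp_finite_nsets)
  have cF: "card (?F Y Z) \<le> 2 ^ (K * K)" for Y Z
  proof (cases "finite (Y \<union> Z) \<and> card (Y \<union> Z) \<le> K")
    case True
    have "card (Y \<union> Z) choose 2 \<le> card (Y \<union> Z) ^ 2"
      by (cases "2 \<le> card (Y \<union> Z)") (auto simp: binomial_le_pow binomial_eq_0)
    also have "\<dots> \<le> K * K" using True by (simp add: power2_eq_square mult_mono)
    finally have "(2::nat) ^ (card (Y \<union> Z) choose 2) \<le> 2 ^ (K * K)" by (intro power_increasing) auto
    then show ?thesis using True by (simp add: card_Pow finite_imp_finite_nsets card_nsets)
  next
    case False
    then show ?thesis by (simp only: if_False card.empty)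
  qed
  have sub: "?D \<subseteq> (\<Union>Y\<in>?Y. \<Union>Z\<in>?Z. ?F Y Z)"
  proof
    fix D assume "D \<in> ?D"
    then have D: "D \<subseteq> [V]\<^bsup>2\<^esup>" "card (\<Union>D) \<le> K" "\<Union>D \<inter> X \<subseteq> B" "card (\<Union>D - X) = k" by auto
    note UV = nsets2_subsetD(1)[OF D(1)] and D2 = nsets2_subsetD(2)[OF D(1)]
    have fin: "finite (\<Union>D)" using UV V finite_subset by blast
    have eq: "(\<Union>D - X) \<union> (\<Union>D \<inter> X) = \<Union>D" by blast
    have "D \<in> ?F (\<Union>D - X) (\<Union>D \<inter> X)" using fin D(2) D2 unfolding eq by simp
    moreover have "\<Union>D - X \<in> ?Y" using UV D(4) by auto
    moreover have "\<Union>D \<inter> X \<in> ?Z" using D(2,3) fin card_mono[OF fin, of "\<Union>D \<inter> X"] by auto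
    ultimately show "D \<in> (\<Union>Y\<in>?Y. \<Union>Z\<in>?Z. ?F Y Z)" by blast
  qed
  have "card ?D \<le> card (\<Union>Y\<in>?Y. \<Union>Z\<in>?Z. ?F Y Z)"
    by (rule card_mono[OF _ sub]) (use fY fZ fF in blast)
  also have "\<dots> \<le> (\<Sum>Y\<in>?Y. card (\<Union>Z\<in>?Z. ?F Y Z))" by (rule card_UN_le[OF fY])
  also have "\<dots> \<le> (\<Sum>Y\<in>?Y. \<Sum>Z\<in>?Z. card (?F Y Z))" by (intro sum_mono card_UN_le[OF fZ])
  also have "\<dots> \<le> (\<Sum>Y\<in>?Y. \<Sum>Z\<in>?Z. 2 ^ (K * K))" by (intro sum_mono cF)
  also have "\<dots> = card ?Y * (card ?Z * 2 ^ (K * K))" by simp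
  also have "\<dots> \<le> card V ^ k * ((card B + 1) ^ K * 2 ^ (K * K))"
    using card_subsets_le_power[OF V, of k] card_small_subsets_le_power[OF B, of K]
    by (intro mult_le_mono) auto
  finally show ?thesis by (simp add: mult.assoc)
qed

lemma card_graphs_le:
  assumes V: "finite V" and v: "v \<le> M"
  shows "card {C. C \<subseteq> [V]\<^bsup>2\<^esup> \<and> card (\<Union>C) = v \<and> card C = l} \<le> card V ^ v * (M * M) ^ l" (is "card ?D \<le> _")
proof -
  let ?Y = "{Y. Y \<subseteq> V \<and> card Y = v}"
  let ?F = "\<lambda>Y. {C. C \<subseteq> [Y]\<^bsup>2\<^esup> \<and> card C = l}"
  have fY: "finite ?Y" using V by auto
  have fin: "finite ([Y]\<^bsup>2\<^esup>)" if "Y \<in> ?Y" for Y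
    using that V finite_subset by (auto intro: finite_imp_finite_nsets)
  have cF: "card (?F Y) \<le> (M * M) ^ l" if "Y \<in> ?Y" for Y
  proof -
    have "card (?F Y) \<le> card ([Y]\<^bsup>2\<^esup>) ^ l" by (rule card_subsets_le_power[OF fin[OF that]])
    also have "\<dots> \<le> (M * M) ^ l"
    proof (rule power_mono)
      have "v choose 2 \<le> v ^ 2" by (cases "2 \<le> v") (auto simp: binomial_le_pow binomial_eq_0)
      also have "\<dots> \<le> M * M" using v by (simp add: power2_eq_square mult_mono)
      finally show "card ([Y]\<^bsup>2\<^esup>) \<le> M * M" using that by (simp add: card_nsets)
    qed simp
    finally show ?thesis .
  qed
  have sub: "?D \<subseteq> (\<Union>Y\<in>?Y. ?F Y)"
  proof
    fix C assume "C \<in> ?D"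
    then have C: "C \<subseteq> [V]\<^bsup>2\<^esup>" "card (\<Union>C) = v" "card C = l" by auto
    have "\<Union>C \<in> ?Y" "C \<subseteq> [\<Union>C]\<^bsup>2\<^esup>" using nsets2_subsetD[OF C(1)] C(2) by simp_all
    then show "C \<in> (\<Union>Y\<in>?Y. ?F Y)" using C(3) by blast
  qed
  have "finite (?F Y)" if "Y \<in> ?Y" for Y using fin[OF that] by simp
  then have "card ?D \<le> card (\<Union>Y\<in>?Y. ?F Y)" using fY by (intro card_mono[OF _ sub]) blast
  also have "\<dots> \<le> (\<Sum>Y\<in>?Y. card (?F Y))" by (rule card_UN_le[OF fY])
  also have "\<dots> \<le> (\<Sum>Y\<in>?Y. (M * M) ^ l)" by (intro sum_mono cF)
  also have "\<dots> = card ?Y * (M * M) ^ l" by simp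
  also have "\<dots> \<le> card V ^ v * (M * M) ^ l"
    using card_subsets_le_power[OF V, of v] by (intro mult_le_mono) auto
  finally show ?thesis .
qed

section \<open>Levels of the exploration and dense subgraphs\<close>

context clique_pair begin

text \<open>A stage of an exploration is represented by its current graph alone. All successors
  allowed by \<open>child\<close> are included, so the levels contain an exploration of every
  critical family in \<open>V\<close>.\<close>

primrec level :: "'a set \<Rightarrow> nat \<Rightarrow> 'a set set set" where
  "level V 0 = {[Q]\<^bsup>2\<^esup> |Q. Q \<subseteq> V \<and> card Q = r}"
| "level V (Suc i) = {S'. S' \<subseteq> [V]\<^bsup>2\<^esup> \<and> (\<exists>S\<in>level V i. child S S')}"

text \<open>The last condition says that the average degree is at least
  \<open>r + 1\<close>.\<close>

definition dense_graphs :: "'a set \<Rightarrow> nat \<Rightarrow> 'a set set set" where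
  "dense_graphs V M = {C. C \<subseteq> [V]\<^bsup>2\<^esup> \<and> C \<noteq> {} \<and> card (\<Union>C) \<le> M \<and> (r + 1) * card (\<Union>C) \<le> 2 * card C}"

lemma level_bounds:
  assumes V: "finite V" and S: "S \<in> level V i"
  shows "S \<subseteq> [V]\<^bsup>2\<^esup> \<and> card (\<Union>S) \<le> ext_size * (i + 1)"
  using S
proof (induction i arbitrary: S)
  case 0
  then obtain Q where Q: "S = [Q]\<^bsup>2\<^esup>" "Q \<subseteq> V" "card Q = r" by auto
  then show ?case using r_le_ext_size r_set(2)[OF Q(3)] by (auto simp: nsets_mono)
next
  case (Suc i)
  then obtain T where T: "S \<subseteq> [V]\<^bsup>2\<^esup>" "T \<in> level V i" "child T S" by auto
  have sub: "\<Union>S \<subseteq> \<Union>T \<union> \<Union>(S - T)" by blast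
  have "\<Union>T \<union> \<Union>(S - T) \<subseteq> V" using T(3) nsets2_subsetD(1)[OF T(1)] unfolding child_def by blast
  then have "finite (\<Union>T \<union> \<Union>(S - T))" using V by (rule finite_subset)
  then have "card (\<Union>S) \<le> card (\<Union>T \<union> \<Union>(S - T))" using sub by (rule card_mono)
  also have "\<dots> \<le> card (\<Union>T) + card (\<Union>(S - T))" by (rule card_Un_le)
  also have "\<dots> \<le> ext_size * (i + 1) + ext_size" using Suc.IH[OF T(2)] T(3) by (intro add_mono) (auto simp: child_def)
  finally show ?case using T(1) by simp
qed

text \<open>The inequality is \<open>critical_degree\<close> summed over the vertices, each edge
  being counted twice. The union is nonempty because the empty family is hit by the empty
  set.\<close>

lemma critical_dense:
  assumes crit: "critical \<B>"
  shows "edge_union \<B> \<noteq> {} \<and> (r + 1) * card (\<Union>(edge_union \<B>)) \<le> 2 * card (edge_union \<B>)"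
proof
  have B: "finite \<B>" "\<forall>Q\<in>\<B>. card Q = r" "\<not> colourable \<B>" using crit by (auto simp: critical_def)
  note eB = edge_union_props[OF B(1,2)]
  show "edge_union \<B> \<noteq> {}"
  proof
    assume "edge_union \<B> = {}"
    then have "\<Union>\<B> = {}" using eB(3) by simp
    then have "\<B> = {}" using B(2) s3 sr by (metis Union_upper card.empty ex_in_conv not_less_zero subset_empty)
    moreover have "clique_free ({} :: 'a set set)" unfolding clique_free_def
    proof (intro allI impI)
      fix A :: "'a set" assume A: "card A = s"
      have "card ([A]\<^bsup>2\<^esup>) = s choose 2" using A by (simp add: card_nsets)
      moreover have "0 < s choose 2" using s3 by simp
      ultimately show "\<not> [A]\<^bsup>2\<^esup> \<subseteq> {}" by (metis card.empty less_irrefl subset_empty)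
    qed
    ultimately have "colourable \<B>" by (auto simp: colourable_def hits_def)
    then show False using B(3) by simp
  qed
  have "(r + 1) * card (\<Union>(edge_union \<B>)) = (\<Sum>x\<in>\<Union>(edge_union \<B>). r + 1)" by simp
  also have "\<dots> \<le> (\<Sum>x\<in>\<Union>(edge_union \<B>). card {e\<in>edge_union \<B>. x \<in> e})"
    using critical_degree[OF crit] unfolding deg_def by (intro sum_mono) simp
  also have "\<dots> = (\<Sum>e\<in>edge_union \<B>. 2)"
  proof (rule sum_multicount_gen[OF eB(4,1)], intro ballI)
    fix e assume e: "e \<in> edge_union \<B>"
    then have "{x \<in> \<Union>(edge_union \<B>). x \<in> e} = e" by blast
    then show "card {x \<in> \<Union>(edge_union \<B>). x \<in> e} = 2" using eB(2) e by simp
  qed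
  also have "\<dots> = 2 * card (edge_union \<B>)" by simp
  finally show "(r + 1) * card (\<Union>(edge_union \<B>)) \<le> 2 * card (edge_union \<B>)" .
qed

text \<open>\<open>child_exists\<close> continues the exploration until the edges of the whole
  family are exhausted; the second alternative records a level at which that has happened.\<close>

lemma critical_reaches:
  assumes V: "finite V" and crit: "critical \<B>" and sub: "\<Union>\<B> \<subseteq> V"
  shows "(\<exists>\<S>\<subseteq>\<B>. \<S> \<noteq> {} \<and> edge_union \<S> \<in> level V L) \<or> (\<exists>i\<le>L. edge_union \<B> \<in> level V i)"
proof (induction L)
  case 0
  have B: "\<forall>Q\<in>\<B>. card Q = r" using crit by (auto simp: critical_def)
  have "\<B> \<noteq> {}" using critical_dense[OF crit] by (auto simp: edge_union_eq)
  then obtain Q where Q: "Q \<in> \<B>" by blast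
  then have "edge_union {Q} \<in> level V 0" using sub B by (auto simp: edge_union_eq)
  then have "{Q} \<subseteq> \<B> \<and> {Q} \<noteq> {} \<and> edge_union {Q} \<in> level V 0" using Q by (simp del: level.simps)
  then show ?case by (rule disjI1[OF exI])
next
  case (Suc L)
  then consider \<S> where "\<S> \<subseteq> \<B>" "\<S> \<noteq> {}" "edge_union \<S> \<in> level V L" "edge_union \<S> \<noteq> edge_union \<B>" | i where "i \<le> L" "edge_union \<B> \<in> level V i"
    by (metis order_refl)
  then show ?case
  proof cases
    case 1
    obtain \<S>' where S': "\<S>' \<subseteq> \<B>" "\<S>' \<noteq> {}" "child (edge_union \<S>) (edge_union \<S>')"
      using child_exists[OF crit 1(1,2,4)] .
    have "edge_union \<S>' \<subseteq> [V]\<^bsup>2\<^esup>"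
      unfolding edge_union_eq
    proof (rule UN_least)
      fix Q assume "Q \<in> \<S>'"
      then have "Q \<subseteq> V" using S'(1) sub by blast
      then show "[Q]\<^bsup>2\<^esup> \<subseteq> [V]\<^bsup>2\<^esup>" by (rule nsets_mono)
    qed
    then have "edge_union \<S>' \<in> level V (Suc L)" using S'(3) 1(3) by auto
    with S'(1,2) have "\<S>' \<subseteq> \<B> \<and> \<S>' \<noteq> {} \<and> edge_union \<S>' \<in> level V (Suc L)" by (simp del: level.simps)
    then show ?thesis by (rule disjI1[OF exI])
  next
    case 2
    then have "i \<le> Suc L \<and> edge_union \<B> \<in> level V i" by (simp del: level.simps)
    then show ?thesis by (rule disjI2[OF exI])
  qed
qed

lemma uncolourable_obstruction:
  assumes V: "finite V" and E: "E \<subseteq> [V]\<^bsup>2\<^esup>"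
    and nc: "\<not> colourable {Q. Q \<subseteq> V \<and> card Q = r \<and> [Q]\<^bsup>2\<^esup> \<subseteq> E}"
  shows "(\<exists>S\<in>level V L. S \<subseteq> E) \<or> (\<exists>C\<in>dense_graphs V (ext_size * (L + 1)). C \<subseteq> E)"
proof -
  let ?A = "{Q. Q \<subseteq> V \<and> card Q = r \<and> [Q]\<^bsup>2\<^esup> \<subseteq> E}"
  have fin: "finite ?A" by (rule finite_subset[of _ "Pow V"]) (use V in auto)
  have "\<forall>Q\<in>?A. card Q = r" by simp
  then obtain \<B> where B: "\<B> \<subseteq> ?A" "critical \<B>" using exists_critical[OF fin _ nc] by blast
  have BE: "edge_union \<S> \<subseteq> E" if "\<S> \<subseteq> \<B>" for \<S> unfolding edge_union_eq by (rule UN_least) (use that B(1) in auto)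
  have "\<Union>\<B> \<subseteq> V" using B(1) by auto
  then consider \<S> where "\<S> \<subseteq> \<B>" "edge_union \<S> \<in> level V L" | i where "i \<le> L" "edge_union \<B> \<in> level V i"
    using critical_reaches[OF V B(2), of L] by blast
  then show ?thesis
  proof cases
    case 1
    then show ?thesis using BE by blast
  next
    case 2
    have "edge_union \<B> \<subseteq> [V]\<^bsup>2\<^esup>" "card (\<Union>(edge_union \<B>)) \<le> ext_size * (i + 1)" using level_bounds[OF V 2(2)] by auto
    moreover have "ext_size * (i + 1) \<le> ext_size * (L + 1)" using 2(1) by simp
    ultimately have "edge_union \<B> \<in> dense_graphs V (ext_size * (L + 1))"
      using critical_dense[OF B(2)] unfolding dense_graphs_def by (blast intro: le_trans)
    then show ?thesis using BE by blast
  qed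
qed

end

lemma sum_UN_le:
  fixes f :: "'b \<Rightarrow> real"
  assumes "finite I" "\<And>i. finite (A i)" "\<And>x. 0 \<le> f x"
  shows "sum f (\<Union>i\<in>I. A i) \<le> (\<Sum>i\<in>I. sum f (A i))"
  using assms(1)
proof (induction rule: finite_induct)
  case (insert i I)
  have fin: "finite (A i)" "finite (\<Union>i\<in>I. A i)" using insert.hyps assms(2) by auto
  have "0 \<le> sum f (A i \<inter> (\<Union>i\<in>I. A i))" using assms(3) by (intro sum_nonneg)
  then have "sum f (A i \<union> (\<Union>i\<in>I. A i)) \<le> sum f (A i) + sum f (\<Union>i\<in>I. A i)"
    using sum.union_inter[OF fin, of f] by linarith
  then show ?case using insert by simp
qed simp

subsection \<open>Expected number of explorations\<close>

text \<open>The factors bound the possible numbers of new vertices and the sets of pairs on the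
  vertices touched by a step.\<close>

definition (in clique_pair) ext_count :: real where "ext_count = (real ext_size + 1) * 2 ^ (ext_size * ext_size)"

locale sparse_density = clique_pair r s for r s :: nat +
  fixes V :: "'a set" and p c :: real
  assumes finV: "finite V" and neV: "V \<noteq> {}" and p_nonneg: "0 \<le> p" and c0: "0 \<le> c" and c1: "c \<le> 1"
    and pc: "p \<le> c * real (card V) powr (- (real_of_int eweight / real_of_int vweight))"
begin

abbreviation n :: real where "n \<equiv> real (card V)"

lemma one_le_n: "1 \<le> n" using finV neV by (simp add: Suc_leI card_gt_0_iff)

lemma p_le_1: "p \<le> 1"
proof -
  have "n powr (- (real_of_int eweight / real_of_int vweight)) \<le> n powr 0"
    using one_le_n eweight_pos vweight_pos by (intro powr_mono) auto
  then have "c * n powr (- (real_of_int eweight / real_of_int vweight)) \<le> 1 * 1"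
    using c0 c1 one_le_n by (intro mult_mono) auto
  then show ?thesis using pc by linarith
qed

text \<open>\<open>k\<close> and \<open>l\<close> are the numbers of new vertices and edges, and
  \<open>h\<close> bounds the drop in potential from below. One of the \<open>l\<close> factors
  \<open>c\<close> is kept; it is all that is gained when \<open>h = 0\<close>.\<close>

lemma power_bound:
  assumes l: "1 \<le> l" and h: "vweight * int k - eweight * int l \<le> - h"
  shows "n ^ k * p ^ l \<le> c * n powr (- (real_of_int h / real_of_int vweight))"
proof -
  have vweight: "real_of_int vweight > 0" using vweight_pos by simp
  have "p ^ l \<le> (c * n powr (- (real_of_int eweight / real_of_int vweight))) ^ l"
    using pc p_nonneg by (rule power_mono)
  also have "\<dots> = c ^ l * n powr (- (real_of_int eweight / real_of_int vweight) * real l)"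
    using one_le_n by (simp add: power_mult_distrib powr_powr flip: powr_realpow)
  finally have "p ^ l \<le> c ^ l * n powr (- (real_of_int eweight / real_of_int vweight) * real l)" .
  moreover have "c ^ l \<le> c" using power_decreasing[OF l c0 c1] by simp
  ultimately have pl: "p ^ l \<le> c * n powr (- (real_of_int eweight / real_of_int vweight) * real l)"
    by (meson mult_right_mono order_trans powr_ge_zero)
  have nk: "n ^ k = n powr real k" using one_le_n by (simp add: powr_realpow)
  have "n ^ k * p ^ l \<le> n powr real k * (c * n powr (- (real_of_int eweight / real_of_int vweight) * real l))"
    unfolding nk using pl by (intro mult_left_mono) auto
  also have "\<dots> = c * n powr (real k - (real_of_int eweight / real_of_int vweight) * real l)"
    by (simp add: powr_add[symmetric] mult.left_commute)
  also have "\<dots> \<le> c * n powr (- (real_of_int h / real_of_int vweight))"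
  proof (intro mult_left_mono powr_mono one_le_n c0)
    have "real_of_int (vweight * int k - eweight * int l) \<le> real_of_int (- h)" using h by (simp only: of_int_le_iff)
    then have "real_of_int (vweight * int k - eweight * int l) / real_of_int vweight \<le> real_of_int (- h) / real_of_int vweight"
      using vweight by (intro divide_right_mono) auto
    moreover have "real_of_int (vweight * int k - eweight * int l) / real_of_int vweight = real k - real_of_int eweight / real_of_int vweight * real l"
      using vweight by (simp add: diff_divide_distrib)
    ultimately show "real k - real_of_int eweight / real_of_int vweight * real l \<le> - (real_of_int h / real_of_int vweight)"
      by simp
  qed
  finally show ?thesis .
qed

text \<open>Group the extensions by the number \<open>k\<close> of new vertices:
  \<open>card_extensions_le\<close> allows a multiple of \<open>n ^ k\<close> of them, and
  \<open>power_bound\<close> gives back the factor \<open>n ^ k\<close>. \<open>F\<close> contains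
  the old vertices at which the step may attach, and only its size enters.\<close>

lemma sum_extensions:
  assumes S: "S \<subseteq> [V]\<^bsup>2\<^esup>" and F: "finite F"
    and ext: "\<And>S'. S' \<in> \<X> \<Longrightarrow> S \<subset> S' \<and> S' \<subseteq> [V]\<^bsup>2\<^esup> \<and> card (\<Union>(S' - S)) \<le> ext_size \<and>
      \<Union>(S' - S) \<inter> \<Union>S \<subseteq> F \<and> potential S' \<le> potential S - h"
  shows "(\<Sum>S'\<in>\<X>. p ^ card S') \<le>
    p ^ card S * (ext_count * (real (card F) + 1) ^ ext_size * c * n powr (- (real_of_int h / real_of_int vweight)))"
proof -
  let ?g = "\<lambda>S'. S' - S" and ?\<kappa> = "\<lambda>D. card (\<Union>D - \<Union>S)"
  let ?w = "c * n powr (- (real_of_int h / real_of_int vweight))"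
  let ?D = "?g ` \<X>"
  have fV2: "finite ([V]\<^bsup>2\<^esup>)" using finV by (rule finite_imp_finite_nsets)
  have fS: "finite S" using S fV2 by (rule finite_subset)
  have inj: "inj_on ?g \<X>" using ext by (intro inj_onI) blast
  have D: "D \<subseteq> [V]\<^bsup>2\<^esup> \<and> D \<noteq> {} \<and> card (\<Union>D) \<le> ext_size \<and> \<Union>D \<inter> \<Union>S \<subseteq> F \<and>
      vweight * int (?\<kappa> D) - eweight * int (card D) \<le> - h \<and> D \<inter> S = {}" if DD: "D \<in> ?D" for D
  proof -
    obtain S' where S': "S' \<in> \<X>" "D = S' - S" using DD by blast
    note e = ext[OF S'(1)]
    have un: "S' = S \<union> D" "D \<inter> S = {}" using e S'(2) by auto
    have fD: "finite D" using e S'(2) finite_subset[OF _ fV2] by auto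
    have "D \<subseteq> [V]\<^bsup>2\<^esup>" using e S'(2) by blast
    then have fUD: "finite (\<Union>D)" using nsets2_subsetD(1) finV finite_subset by metis
    have fUS: "finite (\<Union>S)" using nsets2_subsetD(1)[OF S] finV finite_subset by metis
    have "\<Union>S' = \<Union>S \<union> (\<Union>D - \<Union>S)" using un(1) by blast
    then have "card (\<Union>S') = card (\<Union>S) + ?\<kappa> D"
      using fUD fUS by (metis Diff_disjoint card_Un_disjoint finite_Diff)
    moreover have "card S' = card S + card D" unfolding un(1) using fS fD un(2) by (intro card_Un_disjoint) auto
    ultimately have "potential S' = potential S + (vweight * int (?\<kappa> D) - eweight * int (card D))"
      by (simp add: potential_def algebra_simps)
    then have "vweight * int (?\<kappa> D) - eweight * int (card D) \<le> - h" using e by linarith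
    moreover have "D \<noteq> {}" using e S'(2) by blast
    ultimately show ?thesis using e S'(2) \<open>D \<subseteq> [V]\<^bsup>2\<^esup>\<close> un(2) by simp
  qed
  have "?D \<subseteq> Pow ([V]\<^bsup>2\<^esup>)"
  proof
    fix D assume "D \<in> ?D"
    then show "D \<in> Pow ([V]\<^bsup>2\<^esup>)" using D by blast
  qed
  then have fD: "finite ?D" by (rule finite_subset) (simp add: fV2)
  have \<kappa>: "?\<kappa> ` ?D \<subseteq> {..ext_size}"
  proof
    fix k assume "k \<in> ?\<kappa> ` ?D"
    then obtain D' where D': "D' \<in> ?D" "k = ?\<kappa> D'" by blast
    have "finite (\<Union>D')" using D[OF D'(1)] nsets2_subsetD(1) finV finite_subset by metis
    then have "k \<le> card (\<Union>D')" unfolding D'(2) by (intro card_mono) auto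
    then show "k \<in> {..ext_size}" using D[OF D'(1)] by simp
  qed
  have inner: "(\<Sum>D\<in>{D\<in>?D. ?\<kappa> D = k}. p ^ card D) \<le> (real (card F) + 1) ^ ext_size * 2 ^ (ext_size * ext_size) * ?w" for k
  proof -
    let ?E = "{D\<in>?D. ?\<kappa> D = k}"
    have b: "p ^ card D \<le> ?w / n ^ k" if DE: "D \<in> ?E" for D
    proof -
      have D1: "D \<in> ?D" "?\<kappa> D = k" using DE by auto
      have "finite D" using D[OF D1(1)] fV2 finite_subset by blast
      then have "1 \<le> card D" using D[OF D1(1)] by (simp add: Suc_leI card_gt_0_iff)
      then have "n ^ k * p ^ card D \<le> ?w" using D[OF D1(1)] D1(2) by (intro power_bound) auto
      then show ?thesis using one_le_n by (simp add: field_simps)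
    qed
    have "card ?E \<le> card {D. D \<subseteq> [V]\<^bsup>2\<^esup> \<and> card (\<Union>D) \<le> ext_size \<and> \<Union>D \<inter> \<Union>S \<subseteq> F \<and> card (\<Union>D - \<Union>S) = k}"
    proof (rule card_mono)
      show "finite {D. D \<subseteq> [V]\<^bsup>2\<^esup> \<and> card (\<Union>D) \<le> ext_size \<and> \<Union>D \<inter> \<Union>S \<subseteq> F \<and> card (\<Union>D - \<Union>S) = k}"
        by (rule finite_subset[of _ "Pow ([V]\<^bsup>2\<^esup>)"]) (use fV2 in auto)
      show "?E \<subseteq> {D. D \<subseteq> [V]\<^bsup>2\<^esup> \<and> card (\<Union>D) \<le> ext_size \<and> \<Union>D \<inter> \<Union>S \<subseteq> F \<and> card (\<Union>D - \<Union>S) = k}"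
      proof
        fix D' assume DE: "D' \<in> ?E"
        then have "D' \<in> ?D" by blast
        from D[OF this] DE show "D' \<in> {D. D \<subseteq> [V]\<^bsup>2\<^esup> \<and> card (\<Union>D) \<le> ext_size \<and> \<Union>D \<inter> \<Union>S \<subseteq> F \<and> card (\<Union>D - \<Union>S) = k}"
          by simp
      qed
    qed
    also have "\<dots> \<le> card V ^ k * (card F + 1) ^ ext_size * 2 ^ (ext_size * ext_size)" by (rule card_extensions_le[OF finV F])
    finally have "real (card ?E) \<le> real (card V ^ k * (card F + 1) ^ ext_size * 2 ^ (ext_size * ext_size))" by (simp only: of_nat_le_iff)
    then have cE: "real (card ?E) \<le> n ^ k * (real (card F) + 1) ^ ext_size * 2 ^ (ext_size * ext_size)" by (simp add: add.commute)
    have w0: "0 \<le> ?w / n ^ k" using c0 one_le_n by simp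
    have "(\<Sum>D\<in>?E. p ^ card D) \<le> real (card ?E) * (?w / n ^ k)" using b by (rule sum_bounded_above)
    also have "\<dots> \<le> n ^ k * (real (card F) + 1) ^ ext_size * 2 ^ (ext_size * ext_size) * (?w / n ^ k)"
      using cE w0 by (rule mult_right_mono)
    also have "\<dots> = (real (card F) + 1) ^ ext_size * 2 ^ (ext_size * ext_size) * ?w" using one_le_n by simp
    finally show ?thesis .
  qed
  have "(\<Sum>S'\<in>\<X>. p ^ card S') = (\<Sum>S'\<in>\<X>. p ^ card S * p ^ card (?g S'))"
  proof (rule sum.cong[OF refl])
    fix S' assume S': "S' \<in> \<X>"
    note e = ext[OF S']
    have "finite S'" using e fV2 finite_subset by blast
    then have "card S' = card S + card (S' - S)"
      using e fS card_Diff_subset[of S S'] card_mono[of S' S] by (simp add: psubset_imp_subset)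
    then show "p ^ card S' = p ^ card S * p ^ card (?g S')" by (simp add: power_add)
  qed
  also have "\<dots> = p ^ card S * (\<Sum>D\<in>?D. p ^ card D)"
    using inj by (simp add: sum.reindex sum_distrib_left)
  also have "(\<Sum>D\<in>?D. p ^ card D) = (\<Sum>k\<le>ext_size. \<Sum>D\<in>{D\<in>?D. ?\<kappa> D = k}. p ^ card D)"
    using sum.group[OF fD finite_atMost \<kappa>, of "\<lambda>D. p ^ card D"] by simp
  also have "p ^ card S * \<dots> \<le> p ^ card S * (\<Sum>k\<le>ext_size. (real (card F) + 1) ^ ext_size * 2 ^ (ext_size * ext_size) * ?w)"
    using p_nonneg by (intro mult_left_mono sum_mono inner) auto
  also have "\<dots> = p ^ card S * (ext_count * (real (card F) + 1) ^ ext_size * c * n powr (- (real_of_int h / real_of_int vweight)))"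
    by (simp add: ext_count_def algebra_simps)
  finally show ?thesis .
qed

text \<open>
  Only unsaturated graphs prescribe where to continue. The factor \<open>\<beta>\<close> pays for the free choice
  of the place after a saturated one: a step leading to a saturated graph lowers the potential and
  gains \<open>\<beta> * \<beta>\<close>.
\<close>

definition \<beta> :: real where "\<beta> = n powr (1 / (2 * real_of_int vweight))"

definition weight :: "'a set set \<Rightarrow> real" where
  "weight S = p ^ card S * (if unsaturated S then 1 else \<beta>)"

lemma \<beta>1: "1 \<le> \<beta>" unfolding \<beta>_def using one_le_n vweight_pos by (simp add: ge_one_powr_ge_zero)

text \<open>The potential is an integer, so a strict drop is worth at least this factor.\<close>

lemma \<beta>_sq: "n powr (- (1 / real_of_int vweight)) = 1 / \<beta> * (1 / \<beta>)"
proof -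
  have "\<beta> * \<beta> = n powr (1 / real_of_int vweight)"
    unfolding \<beta>_def powr_add[symmetric] using vweight_pos by (simp add: field_simps)
  then show ?thesis by (simp add: powr_minus_divide)
qed

lemma weight_nonneg: "0 \<le> weight S" unfolding weight_def using p_nonneg \<beta>1 by simp

text \<open>The first summand is for potential-preserving steps at a picked edge, \<open>3\<close>
  being one more than its number of vertices; only \<open>c\<close> makes it small. The second
  covers all other steps, with \<open>M\<close> bounding the places to attach.\<close>

definition growth :: "real \<Rightarrow> real" where
  "growth M = ext_count * 3 ^ ext_size * c + 2 * ext_count * M ^ ext_size / \<beta>"

lemma ext_count_nonneg: "0 \<le> ext_count" unfolding ext_count_def by simp

lemma sum_children:
  assumes S: "S \<subseteq> [V]\<^bsup>2\<^esup>" and M: "real (card (\<Union>S)) + 1 \<le> M"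
  shows "(\<Sum>S'\<in>{S'. S' \<subseteq> [V]\<^bsup>2\<^esup> \<and> child S S'}. weight S') \<le> growth M * weight S"
proof -
  let ?A = "{S'. S' \<subseteq> [V]\<^bsup>2\<^esup> \<and> child S S' \<and> potential S' < potential S}"
  let ?B = "{S'. S' \<subseteq> [V]\<^bsup>2\<^esup> \<and> child S S' \<and> \<not> potential S' < potential S}"
  have fV2: "finite ([V]\<^bsup>2\<^esup>)" using finV by (rule finite_imp_finite_nsets)
  have fin: "finite ?A" "finite ?B" by (rule finite_subset[of _ "Pow ([V]\<^bsup>2\<^esup>)"]; use fV2 in auto)+
  have fU: "finite (\<Union>S)" using nsets2_subsetD(1)[OF S] finV by (rule finite_subset)
  have b0: "\<beta> > 0" using \<beta>1 by simp
  have M0: "1 \<le> M" using M by linarith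
  have MK: "(real (card (\<Union>S)) + 1) ^ ext_size \<le> M ^ ext_size" using M by (intro power_mono) auto
  have pS: "0 \<le> p ^ card S" using p_nonneg by simp
  have A: "(\<Sum>S'\<in>?A. p ^ card S') \<le> p ^ card S * (ext_count * M ^ ext_size / \<beta> / \<beta>)"
  proof -
    have "(\<Sum>S'\<in>?A. p ^ card S') \<le> p ^ card S * (ext_count * (real (card (\<Union>S)) + 1) ^ ext_size * c * n powr (- (real_of_int 1 / real_of_int vweight)))"
      by (rule sum_extensions[OF S fU]) (auto simp: child_def)
    also have "\<dots> \<le> p ^ card S * (ext_count * M ^ ext_size * 1 * n powr (- (real_of_int 1 / real_of_int vweight)))"
      using MK ext_count_nonneg c0 c1 pS M0 by (intro mult_left_mono mult_right_mono mult_mono) auto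
    finally show ?thesis using \<beta>_sq by simp
  qed
  \<comment> \<open>A drop gains \<open>1 / \<beta>\<close> twice and the weight of the child loses
    at most one \<open>\<beta>\<close>.\<close>
  have wA: "(\<Sum>S'\<in>?A. weight S') \<le> \<beta> * (p ^ card S * (ext_count * M ^ ext_size / \<beta> / \<beta>))"
  proof -
    have "(\<Sum>S'\<in>?A. weight S') \<le> (\<Sum>S'\<in>?A. \<beta> * p ^ card S')"
    proof (rule sum_mono)
      fix S' :: "'a set set"
      have "(if unsaturated S' then 1 else \<beta>) * p ^ card S' \<le> \<beta> * p ^ card S'"
        using p_nonneg \<beta>1 by (intro mult_right_mono) auto
      then show "weight S' \<le> \<beta> * p ^ card S'" by (simp add: weight_def mult.commute)
    qed
    also have "\<dots> = \<beta> * (\<Sum>S'\<in>?A. p ^ card S')" by (simp add: sum_distrib_left)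
    finally show ?thesis using A b0 by (meson mult_left_mono less_imp_le order_trans)
  qed
  \<comment> \<open>By \<open>child\<close>, a step without a drop ends in an unsaturated graph,
    whose weight has no factor \<open>\<beta>\<close>.\<close>
  have wB: "(\<Sum>S'\<in>?B. weight S') = (\<Sum>S'\<in>?B. p ^ card S')"
    by (rule sum.cong) (auto simp: child_def weight_def)
  have "?A \<inter> ?B = {}" by blast
  moreover have "{S'. S' \<subseteq> [V]\<^bsup>2\<^esup> \<and> child S S'} = ?A \<union> ?B" by blast
  ultimately have sp: "(\<Sum>S'\<in>{S'. S' \<subseteq> [V]\<^bsup>2\<^esup> \<and> child S S'}. weight S') = (\<Sum>S'\<in>?A. weight S') + (\<Sum>S'\<in>?B. weight S')"
    using fin by (simp add: sum.union_disjoint)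
  have X0: "0 \<le> ext_count * M ^ ext_size / \<beta>" using ext_count_nonneg M0 b0 by simp
  show ?thesis
  proof (cases "unsaturated S")
    case True
    have "\<exists>e. e \<in> S \<and> (\<exists>x\<in>e. deg S x < r)" using True by (auto simp: unsaturated_def)
    then have "pick S \<in> S \<and> (\<exists>x\<in>pick S. deg S x < r)" unfolding pick_def by (rule someI_ex)
    then have cp: "card (pick S) = 2" using nsets2_subsetD(3)[OF S] by blast
    then have fp: "finite (pick S)" by (auto intro: card_ge_0_finite)
    have "(\<Sum>S'\<in>?B. p ^ card S') \<le> p ^ card S * (ext_count * (real (card (pick S)) + 1) ^ ext_size * c * n powr (- (real_of_int 0 / real_of_int vweight)))"
      by (rule sum_extensions[OF S fp]) (use True in \<open>auto simp: child_def\<close>)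
    also have "\<dots> = p ^ card S * (ext_count * 3 ^ ext_size * c)" using one_le_n cp by simp
    finally have B: "(\<Sum>S'\<in>?B. p ^ card S') \<le> p ^ card S * (ext_count * 3 ^ ext_size * c)" .
    have "\<beta> * (p ^ card S * (ext_count * M ^ ext_size / \<beta> / \<beta>)) = p ^ card S * (ext_count * M ^ ext_size / \<beta>)" using b0 by simp
    also have "\<dots> \<le> p ^ card S * (2 * ext_count * M ^ ext_size / \<beta>)" using X0 pS by (intro mult_left_mono) auto
    finally show ?thesis unfolding sp wB using wA B True by (simp add: weight_def growth_def algebra_simps)
  next
    case False
    \<comment> \<open>From a saturated graph the step may attach anywhere. The factor
      \<open>\<beta>\<close> in \<open>weight S\<close> pays for this below.\<close>
    have "(\<Sum>S'\<in>?B. p ^ card S') \<le> p ^ card S * (ext_count * (real (card (\<Union>S)) + 1) ^ ext_size * c * n powr (- (real_of_int 0 / real_of_int vweight)))"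
      by (rule sum_extensions[OF S fU]) (auto simp: child_def)
    also have "\<dots> \<le> p ^ card S * (ext_count * M ^ ext_size * 1 * 1)"
      using MK ext_count_nonneg c0 c1 pS one_le_n M0 by (intro mult_left_mono mult_mono) auto
    finally have B: "(\<Sum>S'\<in>?B. p ^ card S') \<le> p ^ card S * (ext_count * M ^ ext_size)" by simp
    have "\<beta> * (p ^ card S * (ext_count * M ^ ext_size / \<beta> / \<beta>)) = p ^ card S * (ext_count * M ^ ext_size) / \<beta>" using b0 by simp
    also have "\<dots> \<le> p ^ card S * (ext_count * M ^ ext_size)"
    proof -
      have "0 \<le> p ^ card S * (ext_count * M ^ ext_size)" using ext_count_nonneg M0 pS by simp
      then show ?thesis using \<beta>1 divide_left_mono[of 1 \<beta> "p ^ card S * (ext_count * M ^ ext_size)"] by simp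
    qed
    finally have "(\<Sum>S'\<in>?A. weight S') + (\<Sum>S'\<in>?B. weight S') \<le> 2 * (p ^ card S * (ext_count * M ^ ext_size))" using wA wB B by linarith
    also have "\<dots> = (2 * ext_count * M ^ ext_size / \<beta>) * weight S" using False b0 by (simp add: weight_def)
    also have "\<dots> \<le> growth M * weight S" unfolding growth_def using ext_count_nonneg c0 weight_nonneg by (intro mult_right_mono) auto
    finally show ?thesis unfolding sp .
  qed
qed

lemma finite_level: "finite (level V i)"
  by (rule finite_subset[of _ "Pow ([V]\<^bsup>2\<^esup>)"])
    (use level_bounds[OF finV] finV in \<open>auto simp: finite_imp_finite_nsets\<close>)

text \<open>There are at most \<open>n ^ r\<close> initial cliques, of weight at most
  \<open>\<beta>\<close>, and each step multiplies the sum by at most \<open>growth M\<close>.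
  \<open>M\<close> is one more than the vertex bound of \<open>level_bounds\<close> at level
  \<open>L\<close>.\<close>

lemma sum_level:
  assumes "i \<le> L" and M: "M = real (ext_size * (L + 1)) + 1"
  shows "(\<Sum>S\<in>level V i. weight S) \<le> growth M ^ i * (n ^ r * \<beta>)"
  using assms(1)
proof (induction i)
  case 0
  have "weight S \<le> \<beta>" for S :: "'a set set"
  proof -
    have "p ^ card S \<le> 1" using p_nonneg p_le_1 by (rule power_le_one)
    moreover have "(if unsaturated S then 1 else \<beta>) \<le> \<beta>" using \<beta>1 by simp
    ultimately have "weight S \<le> 1 * \<beta>" unfolding weight_def using p_nonneg \<beta>1 by (intro mult_mono) auto
    then show ?thesis by simp
  qed
  then have "(\<Sum>S\<in>level V 0. weight S) \<le> real (card (level V 0)) * \<beta>" by (intro sum_bounded_above) simp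
  also have "real (card (level V 0)) \<le> n ^ r"
  proof -
    have eq: "level V 0 = (\<lambda>Q. [Q]\<^bsup>2\<^esup>) ` {Q. Q \<subseteq> V \<and> card Q = r}" by auto
    have "card (level V 0) \<le> card {Q. Q \<subseteq> V \<and> card Q = r}"
      unfolding eq using finV by (intro card_image_le) auto
    also have "\<dots> \<le> card V ^ r" by (rule card_subsets_le_power[OF finV])
    finally have "real (card (level V 0)) \<le> real (card V ^ r)" by (simp only: of_nat_le_iff)
    then show ?thesis by simp
  qed
  then have "real (card (level V 0)) * \<beta> \<le> n ^ r * \<beta>" using \<beta>1 by (intro mult_right_mono) auto
  finally show ?case by simp
next
  case (Suc i)
  have q0: "0 \<le> growth M" unfolding growth_def using ext_count_nonneg c0 \<beta>1 M by simp
  let ?ch = "\<lambda>S. {S'. S' \<subseteq> [V]\<^bsup>2\<^esup> \<and> child S S'}"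
  have fch: "finite (?ch S)" for S
    by (rule finite_subset[of _ "Pow ([V]\<^bsup>2\<^esup>)"]) (use finV in \<open>auto simp: finite_imp_finite_nsets\<close>)
  have eq: "level V (Suc i) = (\<Union>S\<in>level V i. ?ch S)" by auto
  have "(\<Sum>S\<in>level V (Suc i). weight S) \<le> (\<Sum>S\<in>level V i. \<Sum>S'\<in>?ch S. weight S')"
    unfolding eq using weight_nonneg fch by (intro sum_UN_le finite_level) auto
  also have "\<dots> \<le> (\<Sum>S\<in>level V i. growth M * weight S)"
  proof (rule sum_mono)
    fix S assume S: "S \<in> level V i"
    have lb: "S \<subseteq> [V]\<^bsup>2\<^esup>" "card (\<Union>S) \<le> ext_size * (i + 1)" using level_bounds[OF finV S] by auto
    have "ext_size * (i + 1) \<le> ext_size * (L + 1)" using Suc.prems by simp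
    then have "real (card (\<Union>S)) \<le> real (ext_size * (L + 1))" using lb(2) by (simp only: of_nat_le_iff)
    then show "(\<Sum>S'\<in>?ch S. weight S') \<le> growth M * weight S" using M by (intro sum_children lb(1)) simp
  qed
  also have "\<dots> = growth M * (\<Sum>S\<in>level V i. weight S)" by (simp add: sum_distrib_left)
  also have "\<dots> \<le> growth M * (growth M ^ i * (n ^ r * \<beta>))" using Suc q0 by (intro mult_left_mono) auto
  finally show ?case by (simp add: mult.assoc)
qed

text \<open>For \<open>v\<close> vertices and \<open>l\<close> edges with
  \<open>(r + 1) * v \<le> 2 * l\<close>, \<open>eweight_vweight\<close> gives
  \<open>(r + 1) * (eweight * l - vweight * v) \<ge> 2 * l\<close>, so
  \<open>n ^ v * p ^ l \<le> \<tau> ^ l\<close>. With at most \<open>n ^ v * (M * M) ^ l\<close>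
  such graphs, each pair \<open>(v, l)\<close> contributes at most
  \<open>(M * M * \<tau>) ^ l\<close>, and there are at most \<open>(M + 1) * (M * M)\<close>
  pairs.\<close>

lemma sum_dense:
  assumes small: "real (M * M) * n powr (- 2 / ((real r + 1) * real_of_int vweight)) \<le> 1"
  shows "(\<Sum>C\<in>dense_graphs V M. p ^ card C) \<le>
    (real M + 1) * real (M * M) * (real (M * M) * n powr (- 2 / ((real r + 1) * real_of_int vweight)))"
proof -
  define \<tau> where "\<tau> = n powr (- 2 / ((real r + 1) * real_of_int vweight))"
  have fV2: "finite ([V]\<^bsup>2\<^esup>)" using finV by (rule finite_imp_finite_nsets)
  have fd: "finite (dense_graphs V M)" by (rule finite_subset[of _ "Pow ([V]\<^bsup>2\<^esup>)"]) (use fV2 in \<open>auto simp: dense_graphs_def\<close>)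
  have vweight: "real_of_int vweight > 0" using vweight_pos by simp
  have \<tau>0: "0 \<le> \<tau>" by (simp add: \<tau>_def)
  have bound: "n ^ card (\<Union>C) * p ^ card C \<le> \<tau> ^ card C" if C: "C \<in> dense_graphs V M" for C
  proof -
    have fC: "finite C" using C fV2 finite_subset by (auto simp: dense_graphs_def)
    then have l: "1 \<le> card C" using C by (auto simp: dense_graphs_def Suc_leI card_gt_0_iff)
    let ?h = "eweight * int (card C) - vweight * int (card (\<Union>C))"
    have "n ^ card (\<Union>C) * p ^ card C \<le> c * n powr (- (real_of_int ?h / real_of_int vweight))"
      by (rule power_bound[OF l]) simp
    also have "\<dots> \<le> 1 * n powr (- (real_of_int ?h / real_of_int vweight))" using c1 by (intro mult_right_mono) auto
    also have "\<dots> \<le> n powr ((- 2 / ((real r + 1) * real_of_int vweight)) * real (card C))"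
    proof -
      have "(r + 1) * card (\<Union>C) \<le> 2 * card C" using C by (simp add: dense_graphs_def)
      then have "int ((r + 1) * card (\<Union>C)) \<le> int (2 * card C)" by (simp only: of_nat_le_iff)
      then have "(int r + 1) * int (card (\<Union>C)) \<le> 2 * int (card C)" by (simp only: of_nat_mult of_nat_add of_nat_1 of_nat_numeral)
      then have "vweight * ((int r + 1) * int (card (\<Union>C))) \<le> vweight * (2 * int (card C))" using vweight_pos by (intro mult_left_mono) auto
      moreover have "(int r + 1) * (eweight * int (card C)) = (2 * vweight + 2 * (int r - int s)) * int (card C)"
        unfolding eweight_vweight[symmetric] by (simp add: algebra_simps)
      moreover have "2 * (int r - int s) * int (card C) \<ge> 2 * int (card C)" using sr by (intro mult_right_mono) auto
      ultimately have "2 * int (card C) \<le> (int r + 1) * ?h" by (simp add: algebra_simps)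
      then have "real_of_int (2 * int (card C)) \<le> real_of_int ((int r + 1) * ?h)" by (simp only: of_int_le_iff)
      then have "2 * real (card C) \<le> (real r + 1) * real_of_int ?h" by simp
      then have "2 * real (card C) / ((real r + 1) * real_of_int vweight) \<le> ((real r + 1) * real_of_int ?h) / ((real r + 1) * real_of_int vweight)"
        using vweight by (intro divide_right_mono) auto
      also have "\<dots> = real_of_int ?h / real_of_int vweight" by (rule mult_divide_mult_cancel_left) simp
      finally show ?thesis using one_le_n by (simp add: powr_mono)
    qed
    also have "\<dots> = \<tau> ^ card C" unfolding \<tau>_def using one_le_n by (simp add: powr_powr flip: powr_realpow)
    finally show ?thesis by simp
  qed
  have cellb: "(\<Sum>C\<in>{C\<in>dense_graphs V M. (card (\<Union>C), card C) = (v, l)}. p ^ card C) \<le> real (M * M) * \<tau>"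
    if vl: "v \<le> M" "1 \<le> l" for v l
  proof -
    let ?E = "{C\<in>dense_graphs V M. (card (\<Union>C), card C) = (v, l)}"
    have b: "p ^ card C \<le> \<tau> ^ l / n ^ v" if "C \<in> ?E" for C
      using bound[of C] that one_le_n by (simp add: field_simps)
    have "card ?E \<le> card {C. C \<subseteq> [V]\<^bsup>2\<^esup> \<and> card (\<Union>C) = v \<and> card C = l}"
    proof (rule card_mono)
      show "finite {C. C \<subseteq> [V]\<^bsup>2\<^esup> \<and> card (\<Union>C) = v \<and> card C = l}"
        by (rule finite_subset[of _ "Pow ([V]\<^bsup>2\<^esup>)"]) (use fV2 in auto)
    qed (auto simp: dense_graphs_def)
    also have "\<dots> \<le> card V ^ v * (M * M) ^ l" by (rule card_graphs_le[OF finV vl(1)])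
    finally have "real (card ?E) \<le> real (card V ^ v * (M * M) ^ l)" by (simp only: of_nat_le_iff)
    then have cE: "real (card ?E) \<le> n ^ v * real (M * M) ^ l" by simp
    have "(\<Sum>C\<in>?E. p ^ card C) \<le> real (card ?E) * (\<tau> ^ l / n ^ v)" using b by (rule sum_bounded_above)
    also have "\<dots> \<le> n ^ v * real (M * M) ^ l * (\<tau> ^ l / n ^ v)"
      using cE \<tau>0 by (intro mult_right_mono) auto
    also have "\<dots> = (real (M * M) * \<tau>) ^ l" using one_le_n by (simp add: power_mult_distrib)
    also have "\<dots> \<le> (real (M * M) * \<tau>) ^ 1"
      using small vl(2) \<tau>0 unfolding \<tau>_def[symmetric] by (intro power_decreasing) auto
    finally show ?thesis by simp
  qed
  have img: "(\<lambda>C. (card (\<Union>C), card C)) ` dense_graphs V M \<subseteq> {..M} \<times> {1..M * M}"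
  proof
    fix x assume "x \<in> (\<lambda>C. (card (\<Union>C), card C)) ` dense_graphs V M"
    then obtain C where C: "C \<in> dense_graphs V M" "x = (card (\<Union>C), card C)" by blast
    have CV: "C \<subseteq> [V]\<^bsup>2\<^esup>" "C \<noteq> {}" "card (\<Union>C) \<le> M" using C(1) by (auto simp: dense_graphs_def)
    have fC: "finite C" using CV(1) fV2 by (rule finite_subset)
    have fU: "finite (\<Union>C)" using nsets2_subsetD(1)[OF CV(1)] finV by (rule finite_subset)
    have "card C \<le> card ([\<Union>C]\<^bsup>2\<^esup>)"
      using nsets2_subsetD(2)[OF CV(1)] fU by (intro card_mono finite_imp_finite_nsets)
    also have "\<dots> \<le> card (\<Union>C) ^ 2"
      unfolding card_nsets by (cases "2 \<le> card (\<Union>C)") (auto simp: binomial_le_pow binomial_eq_0)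
    also have "\<dots> \<le> M * M" using CV(3) by (simp add: power2_eq_square mult_mono)
    finally show "x \<in> {..M} \<times> {1..M * M}"
      using C(2) CV(2,3) fC by (simp add: Suc_leI card_gt_0_iff)
  qed
  have "(\<Sum>C\<in>dense_graphs V M. p ^ card C) =
      (\<Sum>x\<in>{..M} \<times> {1..M * M}. \<Sum>C\<in>{C\<in>dense_graphs V M. (card (\<Union>C), card C) = x}. p ^ card C)"
    by (rule sum.group[OF fd _ img, symmetric]) simp
  also have "\<dots> \<le> real (card ({..M} \<times> {1..M * M})) * (real (M * M) * \<tau>)"
    by (rule sum_bounded_above) (use cellb in auto)
  also have "\<dots> = (real M + 1) * real (M * M) * (real (M * M) * \<tau>)" by (simp add: card_cartesian_product algebra_simps)
  finally show ?thesis unfolding \<tau>_def .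
qed

end

subsection \<open>The values of \<open>m\<^sub>2\<close>\<close>

lemma finite_subgraphs:
  assumes "finite (verts H)" "finite (edges H)"
  shows "finite {J :: 'a graph. subgraph J H}"
proof (rule finite_subset)
  show "{J. subgraph J H} \<subseteq> (\<lambda>(A, B). \<lparr>verts = A, edges = B\<rparr>) ` (Pow (verts H) \<times> Pow (edges H))"
  proof
    fix J assume J: "J \<in> {J. subgraph J H}"
    have "J = (\<lambda>(A, B). \<lparr>verts = A, edges = B\<rparr>) (verts J, edges J)" by simp
    moreover have "(verts J, edges J) \<in> Pow (verts H) \<times> Pow (edges H)" using J by (auto simp: subgraph_def)
    ultimately show "J \<in> (\<lambda>(A, B). \<lparr>verts = A, edges = B\<rparr>) ` (Pow (verts H) \<times> Pow (edges H))" by (rule image_eqI)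
  qed
qed (use assms in auto)

lemma clique_graph_simps [simp]: "verts (clique_graph k) = {..<k}" "edges (clique_graph k) = [{..<k}]\<^bsup>2\<^esup>"
  by (simp_all add: clique_graph_def)

lemma finite_subgraphs_clique: "finite {J. subgraph J (clique_graph k)}"
  by (rule finite_subgraphs) (simp_all add: finite_imp_finite_nsets)

lemma subgraph_clique_refl: "subgraph (clique_graph k) (clique_graph k)"
  by (simp add: subgraph_def fin_graph_def)

lemma subgraph_clique_card:
  assumes J: "subgraph J (clique_graph k)" and ne: "edges J \<noteq> {}"
  shows "2 \<le> card (verts J)" "card (verts J) \<le> k"
    "2 * real (card (edges J)) \<le> real (card (verts J)) * (real (card (verts J)) - 1)" "0 < card (edges J)"
proof -
  have f: "finite (verts J)" "edges J \<subseteq> [verts J]\<^bsup>2\<^esup>" using J by (auto simp: subgraph_def fin_graph_def)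
  have fe: "finite (edges J)" using f finite_imp_finite_nsets finite_subset by blast
  obtain e where "e \<in> edges J" using ne by auto
  then have e: "e \<subseteq> verts J" "card e = 2" using f(2) nsets2_iff by blast+
  show "2 \<le> card (verts J)" using card_mono[OF f(1) e(1)] e(2) by simp
  have "verts J \<subseteq> {..<k}" using J by (simp add: subgraph_def)
  then show "card (verts J) \<le> k" using card_mono[of "{..<k}" "verts J"] by simp
  have "card (edges J) \<le> card (verts J) choose 2"
    using card_mono[OF finite_imp_finite_nsets[OF f(1)] f(2)] by (simp add: card_nsets)
  then have "2 * int (card (edges J)) \<le> int (card (verts J)) * (int (card (verts J)) - 1)"
    unfolding two_choose[symmetric] by simp
  then have "real_of_int (2 * int (card (edges J))) \<le> real_of_int (int (card (verts J)) * (int (card (verts J)) - 1))"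
    by (simp only: of_int_le_iff)
  then show "2 * real (card (edges J)) \<le> real (card (verts J)) * (real (card (verts J)) - 1)" by simp
  show "0 < card (edges J)" using ne fe by (simp add: card_gt_0_iff)
qed

lemma real_choose_two: "2 * real (k choose 2) = real k * (real k - 1)"
proof -
  have "real_of_int (2 * int (k choose 2)) = real_of_int (int k * (int k - 1))" by (simp only: two_choose)
  then show ?thesis by simp
qed

text \<open>On \<open>v \<ge> 3\<close> vertices \<open>d2\<close> is at most
  \<open>(v + 1) / 2\<close>, because \<open>(v choose 2) - 1 = (v + 1) * (v - 2) / 2\<close>. The
  default values \<open>0\<close> and \<open>1 / 2\<close> are smaller.\<close>

lemma m2_clique:
  assumes "3 \<le> k"
  shows "0 < m2 (clique_graph k)" "m2 (clique_graph k) \<le> (real k + 1) / 2"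
proof -
  let ?D = "{d2 J |J. subgraph J (clique_graph k)}"
  have fin: "finite ?D" using finite_subgraphs_clique by (simp add: Setcompr_eq_image)
  have ne: "d2 (clique_graph k) \<in> ?D" using subgraph_clique_refl by blast
  have k2: "3 \<le> k choose 2" using binomial_right_mono[OF assms, of 2] by (simp add: choose_two)
  have "[{..<k}]\<^bsup>2\<^esup> \<noteq> {}" using k2 by (metis card.empty card_lessThan card_nsets not_numeral_le_zero)
  then have "0 < d2 (clique_graph k)" using assms k2 by (simp add: d2_def card_nsets)
  also have "\<dots> \<le> m2 (clique_graph k)" unfolding m2_def using fin ne by (rule Max_ge)
  finally show "0 < m2 (clique_graph k)" .
  show "m2 (clique_graph k) \<le> (real k + 1) / 2"
    unfolding m2_def
  proof (rule Max.boundedI[OF fin])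
    show "?D \<noteq> {}" using ne by blast
    fix d assume "d \<in> ?D"
    then obtain J where J: "subgraph J (clique_graph k)" "d = d2 J" by blast
    show "d \<le> (real k + 1) / 2"
    proof (cases "edges J = {} \<or> card (verts J) = 2")
      case True
      then show ?thesis using J(2) assms by (auto simp: d2_def)
    next
      case False
      then have ne: "edges J \<noteq> {}" "card (verts J) \<noteq> 2" by auto
      note c = subgraph_clique_card[OF J(1) ne(1)]
      let ?v = "real (card (verts J))"
      have v3: "?v \<ge> 3" using c(1) ne(2) by linarith
      have "2 * (real (card (edges J)) - 1) \<le> (?v + 1) * (?v - 2)" using c(3) by (simp add: algebra_simps)
      also have "\<dots> \<le> (real k + 1) * (?v - 2)" using c(2) v3 by (intro mult_right_mono) auto
      finally have "real (card (edges J)) - 1 \<le> (real k + 1) / 2 * (?v - 2)" by simp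
      moreover have "d = (real (card (edges J)) - 1) / (?v - 2)" using ne J(2) by (simp add: d2_def)
      ultimately show ?thesis using v3 by (simp only: pos_divide_le_eq)
    qed
  qed
qed

context clique_pair begin

text \<open>As \<open>1 / m2 (clique_graph s)\<close> is at least \<open>y = 2 / (s + 1)\<close>, a
  subgraph on \<open>v\<close> vertices has value at most
  \<open>(v * (v - 1) / 2) / (v - 2 + y)\<close>. This is largest at \<open>v = r\<close>, where
  expanding the fraction by \<open>s + 1\<close> gives \<open>vweight / eweight\<close>.\<close>

lemma m2_pair_clique:
  "0 < m2_pair (clique_graph s) (clique_graph r)"
  "m2_pair (clique_graph s) (clique_graph r) \<le> real_of_int vweight / real_of_int eweight"
proof -
  let ?D = "{d2_pair (clique_graph s) J |J. subgraph J (clique_graph r) \<and> edges J \<noteq> {}}"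
  have fin: "finite ?D"
    by (rule finite_subset[OF _ finite_imageI[OF finite_subgraphs_clique[of r], of "d2_pair (clique_graph s)"]]) auto
  define x where "x = 1 / m2 (clique_graph s)"
  note m = m2_clique[OF s3]
  have x: "2 / (real s + 1) \<le> x" "0 < x"
    using m frac_le[of 1 1 "m2 (clique_graph s)" "(real s + 1) / 2"] by (auto simp: x_def)
  have "0 < r choose 2" using s3 sr by simp
  then have rne: "[{..<r}]\<^bsup>2\<^esup> \<noteq> {}" by (metis card.empty card_lessThan card_nsets less_irrefl)
  then have ne: "d2_pair (clique_graph s) (clique_graph r) \<in> ?D" using subgraph_clique_refl by force
  have "0 < d2_pair (clique_graph s) (clique_graph r)"
    using x(2) \<open>0 < r choose 2\<close> s3 sr by (simp add: d2_pair_def card_nsets x_def[symmetric] add_nonneg_pos)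
  also have "\<dots> \<le> m2_pair (clique_graph s) (clique_graph r)" unfolding m2_pair_def using fin ne by (rule Max_ge)
  finally show "0 < m2_pair (clique_graph s) (clique_graph r)" .
  show "m2_pair (clique_graph s) (clique_graph r) \<le> real_of_int vweight / real_of_int eweight"
    unfolding m2_pair_def
  proof (rule Max.boundedI[OF fin])
    show "?D \<noteq> {}" using ne by blast
    fix d assume "d \<in> ?D"
    then obtain J where J: "subgraph J (clique_graph r)" "edges J \<noteq> {}" "d = d2_pair (clique_graph s) J" by blast
    note c = subgraph_clique_card[OF J(1,2)]
    define v where "v = real (card (verts J))"
    define y where "y = 2 / (real s + 1)"
    have "real s + 1 \<noteq> 0" by linarith
    then have y: "(real s + 1) * y = 2"
      unfolding y_def times_divide_eq_right by (rule nonzero_mult_div_cancel_left)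
    have y0: "0 < y" unfolding y_def by (intro divide_pos_pos) auto
    have v2: "2 \<le> v" "v \<le> real r" using c(1,2) by (auto simp: v_def)
    have eb': "real_of_int eweight = (real s + 1) * (real r - 2 + y)"
      using y by (simp add: eweight_eq algebra_simps)
    have va': "2 * real_of_int vweight = (real s + 1) * (real r * (real r - 1))"
      unfolding vweight_eq real_choose_two[symmetric] by simp
    have "d = real (card (edges J)) / (v - 2 + x)" using J(3) by (simp add: d2_pair_def v_def x_def)
    also have "\<dots> \<le> real (card (edges J)) / (v - 2 + y)"
      using x y0 v2 by (intro divide_left_mono) (auto simp: y_def add_nonneg_pos)
    also have "\<dots> \<le> (v * (v - 1) / 2) / (v - 2 + y)"
      using c(3) y0 v2 by (intro divide_right_mono) (auto simp: v_def)
    also have "\<dots> \<le> (real r * (real r - 1) / 2) / (real r - 2 + y)"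
    proof -
      have rs: "real r \<ge> real s + 1" using sr by simp
      \<comment> \<open>After cross-multiplication the difference of the values at \<open>r\<close>
        and \<open>v\<close> is \<open>r - v\<close> times this expression. For \<open>v = 2\<close>
        it is \<open>(r + 1) * y - 2\<close>, nonnegative as \<open>s < r\<close>; for
        \<open>v \<ge> 3\<close> it is at least \<open>(v - 2) * (r - 2) - 2\<close>.\<close>
      have "0 \<le> real r * v + (y - 2) * (real r + v - 1)"
      proof (cases "v = 2")
        case True
        have "2 \<le> (real r + 1) * y" using y y0 rs mult_right_mono[of "real s + 1" "real r + 1" y] by simp
        then show ?thesis using True by (simp add: algebra_simps)
      next
        case False
        then have "card (verts J) \<noteq> 2" by (auto simp: v_def)
        then have "v \<ge> 3" using c(1) unfolding v_def by linarith
        then have "1 * 2 \<le> (v - 2) * (real r - 2)" using rs s3 by (intro mult_mono) auto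
        moreover have "0 \<le> y * (real r + v - 1)" using y0 v2 by simp
        ultimately show ?thesis by (simp add: algebra_simps)
      qed
      then have "0 \<le> (real r - v) * (real r * v + (y - 2) * (real r + v - 1))" using v2 by simp
      then have "v * (v - 1) * (real r - 2 + y) \<le> real r * (real r - 1) * (v - 2 + y)" by (simp add: algebra_simps)
      moreover have "0 < v - 2 + y" "0 < real r - 2 + y" using v2 y0 by auto
      moreover from calculation have "v * (v - 1) / 2 * (real r - 2 + y) \<le> real r * (real r - 1) / 2 * (v - 2 + y)"
        by simp
      ultimately show ?thesis
        by (intro mult_imp_div_pos_le) (simp_all only: times_divide_eq_left mult_imp_le_div_pos)
    qed
    also have "\<dots> = real_of_int vweight / real_of_int eweight"
    proof -
      have eq: "real_of_int vweight = (real s + 1) * (real r * (real r - 1) / 2)" using va' by simp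
      have ne: "real s + 1 \<noteq> 0" by linarith
      show ?thesis unfolding eb' eq by (rule mult_divide_mult_cancel_left[OF ne, symmetric])
    qed
    finally show "d \<le> real_of_int vweight / real_of_int eweight" .
  qed
qed

text \<open>The threshold is monotone in the density, so the upper bound on \<open>m2_pair\<close>
  turns the hypothesis on \<open>p\<close> into the one of \<open>sparse_density\<close>.\<close>

lemma threshold_le:
  assumes "1 \<le> n"
  shows "n powr (- 1 / m2_pair (clique_graph s) (clique_graph r)) \<le> n powr (- (real_of_int eweight / real_of_int vweight))"
proof -
  have "0 < real_of_int vweight" "0 < real_of_int eweight" using vweight_pos eweight_pos by auto
  then have "real_of_int eweight / real_of_int vweight \<le> 1 / m2_pair (clique_graph s) (clique_graph r)"
    using m2_pair_clique by (simp add: field_simps)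
  then show ?thesis using assms by (intro powr_mono) auto
qed

end

subsection \<open>The random graph\<close>

lemma prob_edges_subset:
  assumes V: "finite V" and p: "0 \<le> p" "p \<le> 1" and S: "S \<subseteq> [V]\<^bsup>2\<^esup>"
  shows "measure_pmf.prob (binomial_random_graph V p) {R. S \<subseteq> edges R} = p ^ card S"
proof -
  let ?A = "[V]\<^bsup>2\<^esup>" and ?B = "\<lambda>e. if e \<in> S then {True} else UNIV"
  have fA: "finite ?A" using V by (rule finite_imp_finite_nsets)
  have "(\<lambda>X. \<lparr>verts = V, edges = {e \<in> ?A. X e}\<rparr>) -` {R. S \<subseteq> edges R} = Pi ?A ?B"
    using S by (auto simp: Pi_def split: if_splits)
  then have "measure_pmf.prob (binomial_random_graph V p) {R. S \<subseteq> edges R} =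
      measure_pmf.prob (Pi_pmf ?A False (\<lambda>_. bernoulli_pmf p)) (Pi ?A ?B)"
    unfolding binomial_random_graph_def by (simp add: measure_map_pmf)
  also have "\<dots> = (\<Prod>e\<in>?A. measure_pmf.prob (bernoulli_pmf p) (?B e))" by (rule measure_Pi_pmf_Pi[OF fA])
  also have "\<dots> = (\<Prod>e\<in>?A. if e \<in> S then p else 1)"
    using p by (intro prod.cong) (auto simp: measure_pmf_single)
  also have "\<dots> = (\<Prod>e\<in>S. p)" using fA S by (intro prod.mono_neutral_cong_right) auto
  finally show ?thesis by simp
qed

lemma prob_contains_member_le:
  assumes V: "finite V" and p: "0 \<le> p" "p \<le> 1" and F: "\<And>S. S \<in> \<F> \<Longrightarrow> S \<subseteq> [V]\<^bsup>2\<^esup>"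
  shows "measure_pmf.prob (binomial_random_graph V p) {R. \<exists>S\<in>\<F>. S \<subseteq> edges R} \<le> (\<Sum>S\<in>\<F>. p ^ card S)"
proof -
  have fF: "finite \<F>"
    by (rule finite_subset[of _ "Pow ([V]\<^bsup>2\<^esup>)"]) (use F V in \<open>auto simp: finite_imp_finite_nsets\<close>)
  have "{R. \<exists>S\<in>\<F>. S \<subseteq> edges R} = (\<Union>S\<in>\<F>. {R :: 'a graph. S \<subseteq> edges R})" by blast
  then have "measure_pmf.prob (binomial_random_graph V p) {R. \<exists>S\<in>\<F>. S \<subseteq> edges R} \<le>
      (\<Sum>S\<in>\<F>. measure_pmf.prob (binomial_random_graph V p) {R. S \<subseteq> edges R})"
    using measure_UNION_le[OF fF, of "\<lambda>S. {R :: 'a graph. S \<subseteq> edges R}"] by simp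
  also have "\<dots> = (\<Sum>S\<in>\<F>. p ^ card S)" using prob_edges_subset[OF V p F] by (intro sum.cong) auto
  finally show ?thesis .
qed

lemma set_binomial_random_graph:
  assumes "R \<in> set_pmf (binomial_random_graph V p)"
  shows "verts R = V" "edges R \<subseteq> [V]\<^bsup>2\<^esup>"
  using assms by (auto simp: binomial_random_graph_def)

text \<open>For \<open>A \<subseteq> V\<close> this is the complete bipartite graph with parts
  \<open>A\<close> and \<open>V - A\<close>.\<close>

definition bipartite_graph :: "'a set \<Rightarrow> 'a set \<Rightarrow> 'a graph" where
  "bipartite_graph V A = \<lparr>verts = V, edges = {e \<in> [V]\<^bsup>2\<^esup>. card (e \<inter> A) = 1}\<rparr>"

lemma card_bipartite_graph:
  assumes "finite V" "A \<subseteq> V"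
  shows "card A * card (V - A) \<le> card (edges (bipartite_graph V A))"
proof -
  let ?f = "\<lambda>(x, y). {x, y}"
  have "inj_on ?f (A \<times> (V - A))" by (auto simp: inj_on_def doubleton_eq_iff)
  then have "card (A \<times> (V - A)) = card (?f ` (A \<times> (V - A)))" by (simp add: card_image)
  also have "\<dots> \<le> card (edges (bipartite_graph V A))"
  proof (rule card_mono)
    show "finite (edges (bipartite_graph V A))"
      using assms(1) by (simp add: bipartite_graph_def finite_imp_finite_nsets)
    show "?f ` (A \<times> (V - A)) \<subseteq> edges (bipartite_graph V A)"
    proof
      fix e assume "e \<in> ?f ` (A \<times> (V - A))"
      then obtain x y where xy: "e = {x, y}" "x \<in> A" "y \<in> V - A" by auto
      then have "e \<inter> A = {x}" "card e = 2" by (auto simp: card_2_iff)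
      then show "e \<in> edges (bipartite_graph V A)" using xy assms by (simp add: bipartite_graph_def nsets2_iff subset_iff)
    qed
  qed
  finally show ?thesis by (simp add: card_cartesian_product)
qed

context clique_pair begin

lemma bipartite_union_not_arrows:
  assumes rs: "2 * s \<le> r + 1" and V: "finite V" and R: "verts R = V" "edges R \<subseteq> [V]\<^bsup>2\<^esup>"
    and col: "colourable {Q. Q \<subseteq> V \<and> card Q = r \<and> [Q]\<^bsup>2\<^esup> \<subseteq> edges R}"
  shows "\<not> arrows (graph_union (bipartite_graph V A) R) (clique_graph r)"
proof -
  obtain T where T: "clique_free T" "hits T {Q. Q \<subseteq> V \<and> card Q = r \<and> [Q]\<^bsup>2\<^esup> \<subseteq> edges R}"
    using col by (auto simp: colourable_def)
  define red where "red e \<longleftrightarrow> card (e \<inter> A) = 1 \<or> e \<in> T" for e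
  have "\<not> mono_copy red (graph_union (bipartite_graph V A) R) (clique_graph r)"
  proof
    assume "mono_copy red (graph_union (bipartite_graph V A) R) (clique_graph r)"
    then obtain f b where f: "inj_on f {..<r}" "f ` {..<r} \<subseteq> V"
      "\<And>e. e \<in> [{..<r}]\<^bsup>2\<^esup> \<Longrightarrow> f ` e \<in> edges (bipartite_graph V A) \<union> edges R \<and> red (f ` e) = b"
      by (auto simp: mono_copy_def graph_union_def clique_graph_def bipartite_graph_def R(1))
    define Q where "Q = f ` {..<r}"
    have cQ: "card Q = r" "Q \<subseteq> V" using f by (simp_all add: Q_def card_image)
    have fQ: "finite Q" by (simp add: Q_def)
    have Q: "g \<in> edges (bipartite_graph V A) \<union> edges R" "red g = b" if "g \<in> [Q]\<^bsup>2\<^esup>" for g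
    proof -
      have g: "g \<subseteq> f ` {..<r}" "card g = 2" using that by (simp_all add: nsets2_iff Q_def)
      then obtain e where e: "e \<subseteq> {..<r}" "g = f ` e" by (meson subset_image_iff)
      then have "card e = 2" using g(2) f(1) by (metis card_image inj_on_subset)
      then have "e \<in> [{..<r}]\<^bsup>2\<^esup>" using e(1) by (simp add: nsets2_iff)
      then show "g \<in> edges (bipartite_graph V A) \<union> edges R" "red g = b" using f(3) e(2) by auto
    qed
    show False
    proof (cases b)
      case True
      have "card (Q \<inter> A) + card (Q - A) = r" using cQ(1) fQ by (metis card_Int_Diff)
      \<comment> \<open>Two parts with fewer than \<open>s\<close> vertices each would give
        \<open>r \<le> 2 * s - 2\<close>, against \<open>rs\<close>. Pairs inside one part are red
        only through \<open>T\<close>.\<close>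
      then have "s \<le> card (Q \<inter> A) \<or> s \<le> card (Q - A)" using rs s3 by linarith
      then obtain B where B: "B \<subseteq> Q" "card B = s" "B \<subseteq> A \<or> B \<inter> A = {}"
      proof
        assume "s \<le> card (Q \<inter> A)"
        then obtain B where "B \<subseteq> Q \<inter> A" "card B = s" by (metis obtain_subset_with_card_n)
        then show ?thesis using that[of B] by auto
      next
        assume "s \<le> card (Q - A)"
        then obtain B where "B \<subseteq> Q - A" "card B = s" by (metis obtain_subset_with_card_n)
        then show ?thesis using that[of B] by auto
      qed
      have "[B]\<^bsup>2\<^esup> \<subseteq> T"
      proof
        fix g assume g: "g \<in> [B]\<^bsup>2\<^esup>"
        then have gQ: "g \<in> [Q]\<^bsup>2\<^esup>" using B(1) nsets_mono by blast
        have gB: "g \<subseteq> B" "card g = 2" using g by (simp_all add: nsets2_iff)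
        have "g \<inter> A = g \<or> g \<inter> A = {}" using gB(1) B(3) by blast
        then have "card (g \<inter> A) \<noteq> 1" using gB(2) by auto
        then show "g \<in> T" using Q(2)[OF gQ] True by (simp add: red_def)
      qed
      then show False using T(1) B(2) by (auto simp: clique_free_def)
    next
      case False
      \<comment> \<open>A blue clique has no cross pair, so all its pairs come from the random graph
        and \<open>T\<close> must hit it.\<close>
      have "[Q]\<^bsup>2\<^esup> \<subseteq> edges R"
      proof
        fix g assume g: "g \<in> [Q]\<^bsup>2\<^esup>"
        have "card (g \<inter> A) \<noteq> 1" using Q(2)[OF g] False by (simp add: red_def)
        then show "g \<in> edges R" using Q(1)[OF g] by (auto simp: bipartite_graph_def)
      qed
      then have "[Q]\<^bsup>2\<^esup> \<inter> T \<noteq> {}" using T(2) cQ by (auto simp: hits_def)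
      then obtain g where "g \<in> [Q]\<^bsup>2\<^esup>" "g \<in> T" by blast
      then show False using Q(2)[of g] False by (simp add: red_def)
    qed
  qed
  then show ?thesis by (auto simp: arrows_def)
qed

end

context sparse_density begin

text \<open>First moment bounds for the two alternatives of \<open>uncolourable_obstruction\<close>.
  In the first, \<open>p ^ card S\<close> is at most \<open>weight S\<close> because
  \<open>\<beta> \<ge> 1\<close>.\<close>

lemma prob_uncolourable_le:
  assumes M: "M = ext_size * (L + 1)"
    and small: "real (M * M) * n powr (- 2 / ((real r + 1) * real_of_int vweight)) \<le> 1"
  shows "measure_pmf.prob (binomial_random_graph V p)
      {R. \<not> colourable {Q. Q \<subseteq> V \<and> card Q = r \<and> [Q]\<^bsup>2\<^esup> \<subseteq> edges R}}
    \<le> growth (real M + 1) ^ L * (n ^ r * \<beta>) +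
      (real M + 1) * real (M * M) * (real (M * M) * n powr (- 2 / ((real r + 1) * real_of_int vweight)))"
proof -
  let ?P = "binomial_random_graph V p"
  let ?A = "{R. \<exists>S\<in>level V L. S \<subseteq> edges R}" and ?B = "{R. \<exists>S\<in>dense_graphs V M. S \<subseteq> edges R}"
  have "measure_pmf.prob ?P {R. \<not> colourable {Q. Q \<subseteq> V \<and> card Q = r \<and> [Q]\<^bsup>2\<^esup> \<subseteq> edges R}}
      \<le> measure_pmf.prob ?P (?A \<union> ?B)"
  proof (rule measure_pmf.finite_measure_mono_AE)
    show "AE R in measure_pmf ?P. R \<in> {R. \<not> colourable {Q. Q \<subseteq> V \<and> card Q = r \<and> [Q]\<^bsup>2\<^esup> \<subseteq> edges R}}
        \<longrightarrow> R \<in> ?A \<union> ?B"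
    proof (rule AE_pmfI, rule impI)
      fix R assume R: "R \<in> set_pmf ?P"
        and nc: "R \<in> {R. \<not> colourable {Q. Q \<subseteq> V \<and> card Q = r \<and> [Q]\<^bsup>2\<^esup> \<subseteq> edges R}}"
      have "(\<exists>S\<in>level V L. S \<subseteq> edges R) \<or> (\<exists>C\<in>dense_graphs V (ext_size * (L + 1)). C \<subseteq> edges R)"
        using nc by (intro uncolourable_obstruction finV set_binomial_random_graph(2)[OF R]) simp
      then show "R \<in> ?A \<union> ?B" unfolding M by simp
    qed
  qed simp
  also have "\<dots> \<le> measure_pmf.prob ?P ?A + measure_pmf.prob ?P ?B" by (rule measure_Un_le) auto
  also have "measure_pmf.prob ?P ?A \<le> (\<Sum>S\<in>level V L. p ^ card S)"
    by (rule prob_contains_member_le[OF finV p_nonneg p_le_1]) (use level_bounds[OF finV] in blast)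
  also have "(\<Sum>S\<in>level V L. p ^ card S) \<le> (\<Sum>S\<in>level V L. weight S)"
  proof (rule sum_mono)
    fix S :: "'a set set"
    have "1 * p ^ card S \<le> (if unsaturated S then 1 else \<beta>) * p ^ card S"
      using p_nonneg \<beta>1 by (intro mult_right_mono) auto
    then show "p ^ card S \<le> weight S" by (simp add: weight_def mult.commute)
  qed
  also have "\<dots> \<le> growth (real M + 1) ^ L * (n ^ r * \<beta>)" by (rule sum_level[OF order_refl]) (simp add: M)
  also have "measure_pmf.prob ?P ?B \<le> (\<Sum>C\<in>dense_graphs V M. p ^ card C)"
    by (rule prob_contains_member_le[OF finV p_nonneg p_le_1]) (simp add: dense_graphs_def)
  also have "\<dots> \<le> (real M + 1) * real (M * M) * (real (M * M) * n powr (- 2 / ((real r + 1) * real_of_int vweight)))"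
    by (rule sum_dense[OF small])
  finally show ?thesis by simp
qed

end

section \<open>Asymptotic estimates\<close>

lemma polylog_tendsto_0:
  fixes \<epsilon> :: real and K k :: nat
  assumes "0 < \<epsilon>"
  shows "(\<lambda>n. (real (K * (nat \<lceil>log 2 (real n)\<rceil> + 1)) + 1) ^ k * real n powr (- \<epsilon>)) \<longlonglongrightarrow> 0"
proof -
  \<comment> \<open>Bounding the logarithm by a multiple of \<open>n powr \<delta>\<close> costs at
    most half of the exponent \<open>\<epsilon>\<close> after taking the \<open>k\<close>-th
    power.\<close>
  define \<delta> where "\<delta> = \<epsilon> / (2 * (real k + 1))"
  have \<delta>: "0 < \<delta>" "real k * \<delta> \<le> \<epsilon> / 2" using assms by (auto simp: \<delta>_def field_simps)
  define A where "A = real K * (1 / (\<delta> * ln 2) + 2) + 1"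
  have bound: "(real (K * (nat \<lceil>log 2 (real n)\<rceil> + 1)) + 1) ^ k * real n powr (- \<epsilon>) \<le> A ^ k * real n powr (- (\<epsilon> / 2))"
    if n: "1 \<le> n" for n :: nat
  proof -
    have x1: "1 \<le> real n powr \<delta>" using n \<delta>(1) by (simp add: ge_one_powr_ge_zero)
    have lg0: "0 \<le> log 2 (real n)" using n by simp
    have "ln (real n) \<le> real n powr \<delta> / \<delta>" using n \<delta>(1) by (intro ln_powr_bound) auto
    then have "log 2 (real n) \<le> (real n powr \<delta> / \<delta>) / ln 2" unfolding log_def by (intro divide_right_mono) auto
    then have lg: "log 2 (real n) \<le> 1 / (\<delta> * ln 2) * real n powr \<delta>" by simp
    have "real (nat \<lceil>log 2 (real n)\<rceil> + 1) \<le> log 2 (real n) + 2" using lg0 by linarith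
    also have "\<dots> \<le> 1 / (\<delta> * ln 2) * real n powr \<delta> + 2 * real n powr \<delta>" using lg x1 by (intro add_mono) auto
    also have "\<dots> = (1 / (\<delta> * ln 2) + 2) * real n powr \<delta>" by (simp only: distrib_right)
    finally have "real K * real (nat \<lceil>log 2 (real n)\<rceil> + 1) \<le> real K * ((1 / (\<delta> * ln 2) + 2) * real n powr \<delta>)"
      by (intro mult_left_mono) auto
    then have "real (K * (nat \<lceil>log 2 (real n)\<rceil> + 1)) + 1 \<le> real K * (1 / (\<delta> * ln 2) + 2) * real n powr \<delta> + 1 * real n powr \<delta>"
      using x1 by (simp only: of_nat_mult mult.assoc)
    also have "\<dots> = A * real n powr \<delta>" by (simp only: A_def distrib_right)
    finally have "(real (K * (nat \<lceil>log 2 (real n)\<rceil> + 1)) + 1) ^ k \<le> (A * real n powr \<delta>) ^ k" by (rule power_mono) simp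
    also have "\<dots> = A ^ k * real n powr (real k * \<delta>)"
      using n by (simp add: power_mult_distrib powr_powr mult.commute flip: powr_realpow)
    also have "\<dots> \<le> A ^ k * real n powr (\<epsilon> / 2)"
    proof -
      have "0 \<le> A" unfolding A_def using \<delta>(1) by simp
      then show ?thesis using n \<delta>(2) by (intro mult_left_mono powr_mono) auto
    qed
    finally have "(real (K * (nat \<lceil>log 2 (real n)\<rceil> + 1)) + 1) ^ k * real n powr (- \<epsilon>) \<le>
        A ^ k * real n powr (\<epsilon> / 2) * real n powr (- \<epsilon>)" by (intro mult_right_mono) auto
    also have "\<dots> = A ^ k * real n powr (- (\<epsilon> / 2))"
      by (simp add: mult.assoc powr_add[symmetric])
    finally show ?thesis .
  qed
  have "(\<lambda>n. real n powr (- (\<epsilon> / 2))) \<longlonglongrightarrow> 0"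
    using assms by (intro tendsto_neg_powr filterlim_real_sequentially) auto
  then have lim: "(\<lambda>n. A ^ k * real n powr (- (\<epsilon> / 2))) \<longlonglongrightarrow> 0" by (rule tendsto_mult_right_zero)
  show ?thesis
  proof (rule tendsto_sandwich[OF _ _ tendsto_const lim])
    show "\<forall>\<^sub>F n in sequentially. 0 \<le> (real (K * (nat \<lceil>log 2 (real n)\<rceil> + 1)) + 1) ^ k * real n powr (- \<epsilon>)" by simp
    show "\<forall>\<^sub>F n in sequentially. (real (K * (nat \<lceil>log 2 (real n)\<rceil> + 1)) + 1) ^ k * real n powr (- \<epsilon>)
        \<le> A ^ k * real n powr (- (\<epsilon> / 2))"
      using eventually_ge_at_top[of 1] by eventually_elim (rule bound)
  qed
qed

context clique_pair begin

text \<open>\<open>c\<close> is such that the first summand of \<open>growth\<close> equals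
  \<open>(1 / 2) ^ (r + 3)\<close>. The second is eventually smaller, so \<open>growth\<close> is at
  most \<open>(1 / 2) ^ (r + 2)\<close>, and after \<open>\<lceil>log 2 n\<rceil>\<close> steps its
  power is at most \<open>1 / n ^ (r + 2)\<close>. This beats the initial
  \<open>n ^ r * \<beta> \<le> n ^ (r + 1)\<close>.\<close>

lemma uncolourable_tendsto_0:
  defines "c \<equiv> 1 / (ext_count * 3 ^ ext_size * 2 ^ (r + 3))"
  assumes p: "\<And>n. 2 \<le> n \<Longrightarrow> 0 \<le> p n \<and> p n \<le> c * real n powr (- (real_of_int eweight / real_of_int vweight))"
  shows "(\<lambda>n. measure_pmf.prob (binomial_random_graph {..<n} (p n))
    {R. \<not> colourable {Q. Q \<subseteq> {..<n} \<and> card Q = r \<and> [Q]\<^bsup>2\<^esup> \<subseteq> edges R}}) \<longlonglongrightarrow> 0"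
    (is "?f \<longlonglongrightarrow> 0")
proof -
  have C01: "1 \<le> ext_count"
  proof -
    have "1 * 1 \<le> (real ext_size + 1) * 2 ^ (ext_size * ext_size)" by (intro mult_mono) auto
    then show ?thesis by (simp add: ext_count_def)
  qed
  have "1 * 1 * 1 \<le> ext_count * 3 ^ ext_size * 2 ^ (r + 3)" using C01 by (intro mult_mono) auto
  then have c: "0 \<le> c" "c \<le> 1" by (auto simp: c_def)
  define L where "L n = nat \<lceil>log 2 (real n)\<rceil>" for n :: nat
  define M where "M n = ext_size * (L n + 1)" for n
  define e1 where "e1 = 1 / (2 * real_of_int vweight)"
  define e2 where "e2 = 2 / ((real r + 1) * real_of_int vweight)"
  have va1: "1 \<le> real_of_int vweight" using vweight_pos by simp
  have e: "0 < e1" "e1 \<le> 1" "0 < e2" using va1 by (auto simp: e1_def e2_def add_nonneg_pos)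
  have lim1: "(\<lambda>n. 2 * ext_count * ((real (M n) + 1) ^ ext_size * real n powr (- e1))) \<longlonglongrightarrow> 0"
    unfolding M_def L_def by (intro tendsto_mult_right_zero polylog_tendsto_0 e)
  \<comment> \<open>The exponent \<open>5\<close> collects the factors \<open>M + 1\<close>,
    \<open>M * M\<close> and \<open>M * M\<close> from \<open>sum_dense\<close>.\<close>
  have lim2: "(\<lambda>n. (real (M n) + 1) ^ 5 * real n powr (- e2)) \<longlonglongrightarrow> 0"
    unfolding M_def L_def by (intro polylog_tendsto_0 e)
  have ev1: "\<forall>\<^sub>F n in sequentially. 2 * ext_count * ((real (M n) + 1) ^ ext_size * real n powr (- e1)) < (1 / 2) ^ (r + 3)"
    using lim1 by (rule order_tendstoD(2)) simp
  have ev2: "\<forall>\<^sub>F n in sequentially. (real (M n) + 1) ^ 5 * real n powr (- e2) < 1"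
    using lim2 by (rule order_tendstoD(2)) simp
  have bound: "\<forall>\<^sub>F n in sequentially. ?f n \<le> 1 / real n + (real (M n) + 1) ^ 5 * real n powr (- e2)"
    using ev1 ev2 eventually_ge_at_top[of 2]
  proof eventually_elim
    case (elim n)
    have n2: "2 \<le> n" by (rule elim(3))
    interpret sparse_density r s "{..<n}" "p n" c
      by unfold_locales (use p[OF n2] c n2 in \<open>auto simp: lessThan_empty_iff\<close>)
    let ?m = "real (M n) + 1"
    have m1: "1 \<le> ?m" by simp
    have mp: "?m ^ i \<le> ?m ^ 5" if "i \<le> 5" for i using that m1 by (rule power_increasing)
    have mm: "real (M n * M n) \<le> ?m ^ 2"
      using mult_mono[of "real (M n)" ?m "real (M n)" ?m] by (simp add: power2_eq_square)
    have t: "n powr (- 2 / ((real r + 1) * real_of_int vweight)) = real n powr (- e2)" by (simp add: e2_def)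
    have "real (M n * M n) * real n powr (- e2) \<le> ?m ^ 5 * real n powr (- e2)"
      using mm mp[of 2] by (intro mult_right_mono) auto
    then have small: "real (M n * M n) * real n powr (- e2) \<le> 1" using elim(2) by linarith
    have \<beta>': "\<beta> = real n powr e1" by (simp add: \<beta>_def e1_def)
    have \<beta>n: "\<beta> \<le> real n" unfolding \<beta>' using powr_mono[OF e(2), of "real n"] n2 by simp
    have "growth ?m = ext_count * 3 ^ ext_size * c + 2 * ext_count * (?m ^ ext_size * real n powr (- e1))"
      unfolding growth_def \<beta>' by (simp add: powr_minus_divide)
    also have "ext_count * 3 ^ ext_size * c = (1 / 2) ^ (r + 3)" unfolding c_def using C01 by (simp add: power_add power_one_over power3_eq_cube)
    finally have "growth ?m \<le> (1 / 2) ^ (r + 3) + (1 / 2) ^ (r + 3)" using elim(1) by linarith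
    also have "\<dots> = (1 / 2) ^ (r + 2)"
    proof -
      have "r + 3 = Suc (r + 2)" by simp
      then show ?thesis by (simp only: power_Suc)
    qed
    finally have q: "growth ?m \<le> (1 / 2) ^ (r + 2)" .
    have q0: "0 \<le> growth ?m" unfolding growth_def using C01 c \<beta>1 by simp
    have "real n \<le> 2 ^ L n"
    proof -
      have "log 2 (real n) \<le> real (L n)" unfolding L_def by linarith
      then have "2 powr log 2 (real n) \<le> 2 powr real (L n)" by (intro powr_mono) auto
      then show ?thesis using n2 by (simp add: powr_realpow)
    qed
    then have nL: "real n ^ (r + 2) \<le> (2 ^ L n) ^ (r + 2)" by (intro power_mono) auto
    have "growth ?m ^ L n \<le> ((1 / 2) ^ (r + 2)) ^ L n" using q q0 by (intro power_mono) auto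
    also have "\<dots> = 1 / (2 ^ L n) ^ (r + 2)" by (simp only: power_one_over power_mult[symmetric] mult.commute)
    also have "\<dots> \<le> 1 / real n ^ (r + 2)" using nL n2 by (intro divide_left_mono) auto
    finally have qL: "growth ?m ^ L n \<le> 1 / real n ^ (r + 2)" .
    have "growth ?m ^ L n * (real n ^ r * \<beta>) \<le> 1 / real n ^ (r + 2) * (real n ^ r * real n)"
      using qL \<beta>n q0 \<beta>1 by (intro mult_mono) auto
    also have "\<dots> = 1 / real n" using n2 by (simp add: power_add power2_eq_square)
    finally have first: "growth ?m ^ L n * (real n ^ r * \<beta>) \<le> 1 / real n" .
    have "?m * real (M n * M n) * (real (M n * M n) * real n powr (- e2)) \<le> ?m * ?m ^ 2 * (?m ^ 2 * real n powr (- e2))"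
      using mm by (intro mult_mono) auto
    also have "\<dots> = ?m ^ 5 * real n powr (- e2)" by (simp add: power_numeral_reduce)
    finally have second: "?m * real (M n * M n) * (real (M n * M n) * real n powr (- e2)) \<le> ?m ^ 5 * real n powr (- e2)" .
    have "?f n \<le> growth ?m ^ L n * (real n ^ r * \<beta>) + ?m * real (M n * M n) * (real (M n * M n) * real n powr (- e2))"
      using prob_uncolourable_le[of "M n" "L n"] small by (simp add: M_def e2_def)
    then show ?case using first second by linarith
  qed
  have "(\<lambda>n. 1 / real n + (real (M n) + 1) ^ 5 * real n powr (- e2)) \<longlonglongrightarrow> 0 + 0"
    by (intro tendsto_add lim_1_over_n lim2)
  then have lim: "(\<lambda>n. 1 / real n + (real (M n) + 1) ^ 5 * real n powr (- e2)) \<longlonglongrightarrow> 0" by simp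
  show ?thesis by (rule tendsto_sandwich[OF _ bound tendsto_const lim]) simp
qed

end

theorem theorem1p4:
  fixes r :: nat and \<gamma> :: real
  assumes "r \<ge> 5" and "0 < \<gamma>" and "\<gamma> < 1 / 4"
  shows "\<exists>c::real. c > 0 \<and> (\<exists>G :: nat \<Rightarrow> nat graph.
    (\<forall>n\<ge>2. fin_graph (G n) \<and> card (verts (G n)) = n \<and>
            real (card (edges (G n))) \<ge> \<gamma> * (real n)\<^sup>2) \<and>
    (\<forall>p :: nat \<Rightarrow> real.
      (\<forall>n\<ge>2. 0 \<le> p n \<and> p n \<le> 1 \<and>
        p n \<le> c * real n powr (- 1 / m2_pair (clique_graph (nat \<lceil>real r / 2\<rceil>)) (clique_graph r))) \<longrightarrow>
      (\<lambda>n. measure_pmf.prob (binomial_random_graph (verts (G n)) (p n))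
             {R. \<not> arrows (graph_union (G n) R) (clique_graph r)}) \<longlonglongrightarrow> 1))"
proof -
  define s where "s = nat \<lceil>real r / 2\<rceil>"
  \<comment> \<open>\<open>r \<ge> 5\<close> ensures \<open>s \<ge> 3\<close>; the last inequality
    serves the pigeonhole argument for the two parts.\<close>
  have s: "3 \<le> s" "s < r" "2 * s \<le> r + 1" unfolding s_def using assms(1) by linarith+
  interpret clique_pair r s using s by unfold_locales
  define c where "c = 1 / (ext_count * 3 ^ ext_size * 2 ^ (r + 3))"
  have cpos: "0 < c" unfolding c_def ext_count_def by (simp add: add_nonneg_pos)
  define bip where "bip n = bipartite_graph {..<n} {..<n div 2}" for n :: nat
  define big where "big n \<longleftrightarrow> \<gamma> * (real n)\<^sup>2 \<le> real (card (edges (bip n)))" for n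
  \<comment> \<open>For small \<open>n\<close> the bipartite graph may have fewer than \<open>\<gamma> n\<^sup>2\<close> edges, e.g. for \<open>n = 3\<close>.\<close>
  define G where "G n = (if big n then bip n else clique_graph n)" for n
  have v: "verts (G n) = {..<n}" for n by (simp add: G_def bip_def bipartite_graph_def)
  have fg: "fin_graph (G n)" for n by (auto simp: G_def bip_def bipartite_graph_def fin_graph_def)
  have eG: "\<gamma> * (real n)\<^sup>2 \<le> real (card (edges (G n)))" if n: "2 \<le> n" for n
  proof (cases "big n")
    case False
    have "\<gamma> * (real n)\<^sup>2 \<le> 1 / 4 * (real n)\<^sup>2" using assms(3) by (intro mult_right_mono) auto
    also have "\<dots> \<le> real n * (real n - 1) / 2"
    proof -
      have "0 \<le> real n * (real n - 2)" using n by simp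
      then show ?thesis by (simp add: power2_eq_square algebra_simps)
    qed
    also have "\<dots> = real (n choose 2)" using real_choose_two[of n] by simp
    finally show ?thesis using False by (simp add: G_def card_nsets)
  qed (simp add: G_def big_def)
  have "\<forall>\<^sub>F n in sequentially. big n"
  proof -
    \<comment> \<open>The balanced bipartite graph has at least \<open>n^2 / 4 - 1\<close> edges,
      and \<open>d * n^2 \<ge> 1\<close> as soon as \<open>d * n \<ge> 1\<close>.\<close>
    define d where "d = 1 / 4 - \<gamma>"
    have d: "0 < d" using assms(3) by (simp add: d_def)
    obtain N :: nat where N: "1 / d \<le> real N" using real_arch_simple by blast
    have "big n" if n: "N \<le> n" "1 \<le> n" for n
    proof -
      have "1 / d \<le> real n" using N n by linarith
      then have "1 \<le> d * real n" using d by (simp add: field_simps)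
      also have "\<dots> \<le> d * (real n)\<^sup>2" using d n by (intro mult_left_mono) (auto simp: power2_eq_square)
      finally have 1: "\<gamma> * (real n)\<^sup>2 \<le> (real n)\<^sup>2 / 4 - 1" by (simp add: d_def algebra_simps)
      let ?h = "n div 2"
      have sub: "{..<?h} \<subseteq> {..<n}" by auto
      have "real ?h * real (n - ?h) \<ge> (real n)\<^sup>2 / 4 - 1"
      proof -
        consider "n = 2 * ?h" | "n = 2 * ?h + 1" by linarith
        then show ?thesis
        proof cases
          case 1
          then have "real n = 2 * real ?h" "real (n - ?h) = real ?h" by linarith+
          then show ?thesis by (simp add: power2_eq_square)
        next
          case 2
          then have "real n = 2 * real ?h + 1" "real (n - ?h) = real ?h + 1" by linarith+
          then show ?thesis by (simp add: power2_eq_square algebra_simps)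
        qed
      qed
      moreover have "card {..<?h} * card ({..<n} - {..<?h}) \<le> card (edges (bip n))"
        unfolding bip_def by (rule card_bipartite_graph[OF finite_lessThan sub])
      then have "real (?h * (n - ?h)) \<le> real (card (edges (bip n)))"
        using card_Diff_subset[OF finite_lessThan sub] by (simp only: of_nat_le_iff card_lessThan)
      ultimately show ?thesis using 1 unfolding big_def by simp
    qed
    then show ?thesis unfolding eventually_sequentially by (metis max.bounded_iff)
  qed
  have main: "(\<lambda>n. measure_pmf.prob (binomial_random_graph (verts (G n)) (p n))
             {R. \<not> arrows (graph_union (G n) R) (clique_graph r)}) \<longlonglongrightarrow> 1"
    if p: "\<forall>n\<ge>2. 0 \<le> p n \<and> p n \<le> 1 \<and>
        p n \<le> c * real n powr (- 1 / m2_pair (clique_graph s) (clique_graph r))" for p :: "nat \<Rightarrow> real"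
  proof -
    let ?bad = "\<lambda>n. {R. \<not> colourable {Q. Q \<subseteq> {..<n} \<and> card Q = r \<and> [Q]\<^bsup>2\<^esup> \<subseteq> edges R}}"
    let ?P = "\<lambda>n. binomial_random_graph {..<n} (p n)"
    have "p n \<le> c * real n powr (- (real_of_int eweight / real_of_int vweight))" if "2 \<le> n" for n
    proof -
      have "c * real n powr (- 1 / m2_pair (clique_graph s) (clique_graph r)) \<le> c * real n powr (- (real_of_int eweight / real_of_int vweight))"
        using cpos that by (intro mult_left_mono threshold_le) auto
      then show ?thesis using p that by (meson order_trans)
    qed
    then have "(\<lambda>n. measure_pmf.prob (?P n) (?bad n)) \<longlonglongrightarrow> 0"
      using p by (intro uncolourable_tendsto_0) (auto simp: c_def)
    then have "(\<lambda>n. 1 - measure_pmf.prob (?P n) (?bad n)) \<longlonglongrightarrow> 1 - 0" by (intro tendsto_diff tendsto_const)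
    then have lim: "(\<lambda>n. 1 - measure_pmf.prob (?P n) (?bad n)) \<longlonglongrightarrow> 1" by simp
    show ?thesis
    proof (rule tendsto_sandwich[OF _ _ lim tendsto_const])
      show "\<forall>\<^sub>F n in sequentially. 1 - measure_pmf.prob (?P n) (?bad n) \<le>
          measure_pmf.prob (binomial_random_graph (verts (G n)) (p n)) {R. \<not> arrows (graph_union (G n) R) (clique_graph r)}"
        using \<open>\<forall>\<^sub>F n in sequentially. big n\<close>
      proof eventually_elim
        \<comment> \<open>For such \<open>n\<close> the host graph is bipartite, so every outcome
          outside \<open>?bad n\<close> has a good colouring. The finitely many other
          \<open>n\<close> do not affect the limit.\<close>
        case (elim n)
        have "1 - measure_pmf.prob (?P n) (?bad n) = measure_pmf.prob (?P n) (- ?bad n)"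
          using measure_pmf.prob_compl[of "?bad n" "?P n"] by (simp add: Compl_eq_Diff_UNIV)
        also have "\<dots> \<le> measure_pmf.prob (?P n) {R. \<not> arrows (graph_union (G n) R) (clique_graph r)}"
        proof (rule measure_pmf.finite_measure_mono_AE)
          show "AE R in measure_pmf (?P n). R \<in> - ?bad n \<longrightarrow> R \<in> {R. \<not> arrows (graph_union (G n) R) (clique_graph r)}"
          proof (rule AE_pmfI, rule impI)
            fix R assume R: "R \<in> set_pmf (?P n)" "R \<in> - ?bad n"
            note R' = set_binomial_random_graph[OF R(1)]
            have "\<not> arrows (graph_union (bipartite_graph {..<n} {..<n div 2}) R) (clique_graph r)"
              using R(2) by (intro bipartite_union_not_arrows[OF s(3) finite_lessThan R']) simp
            then show "R \<in> {R. \<not> arrows (graph_union (G n) R) (clique_graph r)}"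
              using elim by (simp add: G_def bip_def)
          qed
        qed simp
        finally show ?case unfolding v .
      qed
    qed simp
  qed
  show ?thesis
    by (rule exI[of _ c], rule conjI[OF cpos], rule exI[of _ G])
      (use fg v eG main in \<open>simp add: s_def\<close>)
qed

end
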